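(* $\Sigma_+\cap\Sigma_-=\emptyset$, as substacks of $\Sigma'$ (i.e., no nonempty scheme has a point of $\Sigma'$ lying in both).
   Context: Fix a prime $p$. A c-stack is a stack of categories on the category of schemes with the fpqc topology. A scheme $S$ is $p$-nilpotent if $p\in H^0(S,\mathcal{O}_S)$ is locally nilpotent. $W$ is the ring scheme of $p$-typical Witt vectors with $F,V$; $W_n$ the truncated version; $W_S:=W\times S$. A $W_S$-module is a commutative affine group scheme over $S$ with an action of the ring scheme $W_S$. $M^{(1)}$ is $M$ with the action precomposed with $F:W_S\to W_S$. $W_S^{(F)}:=\operatorname{Ker}(F:W_S\to W_S^{(1)})$; $W_S$ acts on it through $W_S/V(W_S^{(1)})=(\mathbb{G}_a)_S$; for a line bundle $\mathscr{L}$ on $S$ put $\mathscr{L}^\sharp:=\mathscr{L}\otimes_{(\mathbb{G}_a)_S}W_S^{(F)}$. The functor $\mathscr{L}\mapsto\mathscr{L}^\sharp$ is an equivalence between line bundles on $S$ and $W_S$-modules fpqc-locally isomorphic to $W_S^{(F)}$. $M$ is invertible if it is fpqc-locally isomorphic to $W_S$, and admissible if there is an exact sequence $0\to\mathscr{L}^\sharp\to M\to M'\to0$ with $\mathscr{L}$ a line bundle and $M'$ fpqc-locally isomorphic to $W_S^{(1)}$; this sequence is unique and functorial in $M$, and invertible modules are admissible. For $p$-nilpotent $S$, a $W_S$-linear map $\xi:M\to W_S$ is primitive if for every $s\in S$ one has $(M_s)_{\rm red}\subset\operatorname{Ker}\xi_1$ and $(M_s)_{\rm red}\not\subset\operatorname{Ker}\xi_2$,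 where $\xi_n:M\xrightarrow{\xi}W_S\to(W_n)_S$. $\Sigma'$ is the c-stack such that $\Sigma'(S)=\emptyset$ if $S$ is not $p$-nilpotent and otherwise $\Sigma'(S)$ is the category of pairs $(M,\xi)$ with $M$ an admissible $W_S$-module and $\xi:M\to W_S$ primitive, morphisms being $W_S$-linear maps over $W_S$. $\Sigma_+(S)\subset\Sigma'(S)$ is the full subcategory of pairs with $M$ invertible. For $(M,\xi)\in\Sigma'(S)$, $\xi$ maps $\mathscr{L}^\sharp$ to $W_S^{(F)}=\mathcal{O}_S^\sharp$, and this map comes from a unique $v_-:\mathscr{L}\to\mathcal{O}_S$; $\Sigma_-(S)\subset\Sigma'(S)$ is the full subcategory of those $(M,\xi)$ for which $v_-$ is an isomorphism. *)

theory Defs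
  imports
    "HOL-Algebra.Ideal"
    "HOL-Algebra.Module"
    "HOL-Algebra.Free_Abelian_Groups"
    "HOL-Computational_Algebra.Primes"
begin

text \<open>
  Schemes are treated through their functor of points (Demazure--Gabriel): a scheme is a Zariski
  sheaf on commutative rings which has an open covering by affine schemes.  The rings are those
  carried by a fixed type \<open>'u\<close>; for infinite \<open>'u\<close> these are, up to isomorphism, all rings of
  cardinality at most that of \<open>'u\<close>, and the class is closed under quotients, localisations, tensor
  products, residue fields and polynomial rings in countably many variables.  Since \<open>'u\<close> is a type
  variable, it plays the role of an arbitrary cardinality bound for the site.
\<close>

section \<open>Schemes as functors of points\<close>

record ('u, 's) ring_fun =
  pts :: "'u ring \<Rightarrow> 's set"
  res :: "'u ring \<Rightarrow> 'u ring \<Rightarrow> ('u \<Rightarrow> 'u) \<Rightarrow> 's \<Rightarrow> 's"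

text \<open>Only the values of a homomorphism on the carrier of its source may matter, whence the
  congruence condition.\<close>

definition is_functor :: "('u, 's) ring_fun \<Rightarrow> bool" where
  "is_functor X \<longleftrightarrow>
     (\<forall>A B \<phi> x. cring A \<and> cring B \<and> \<phi> \<in> ring_hom A B \<and> x \<in> pts X A \<longrightarrow> res X A B \<phi> x \<in> pts X B) \<and>
     (\<forall>A x. cring A \<and> x \<in> pts X A \<longrightarrow> res X A A id x = x) \<and>
     (\<forall>A B C \<phi> \<psi> x. cring A \<and> cring B \<and> cring C \<and> \<phi> \<in> ring_hom A B \<and> \<psi> \<in> ring_hom B C \<and> x \<in> pts X A
        \<longrightarrow> res X B C \<psi> (res X A B \<phi> x) = res X A C (\<psi> \<circ> \<phi>) x) \<and>
     (\<forall>A B \<phi> \<psi> x. cring A \<and> cring B \<and> \<phi> \<in> ring_hom A B \<and> \<psi> \<in> ring_hom A B \<and> x \<in> pts X A \<and>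
        (\<forall>a \<in> carrier A. \<phi> a = \<psi> a) \<longrightarrow> res X A B \<phi> x = res X A B \<psi> x)"

definition Spec :: "'u ring \<Rightarrow> ('u, 'u \<Rightarrow> 'u) ring_fun" where
  "Spec A = \<lparr>pts = (\<lambda>R. ring_hom A R \<inter> extensional (carrier A)),
             res = (\<lambda>R R' \<phi> \<chi>. restrict (\<phi> \<circ> \<chi>) (carrier A))\<rparr>"

definition is_localization :: "'u ring \<Rightarrow> 'u \<Rightarrow> 'u ring \<Rightarrow> ('u \<Rightarrow> 'u) \<Rightarrow> bool" where
  "is_localization R f R' \<phi> \<longleftrightarrow>
     cring R' \<and> \<phi> \<in> ring_hom R R' \<and> \<phi> f \<in> Units R' \<and>
     (\<forall>y \<in> carrier R'. \<exists>a \<in> carrier R. \<exists>n::nat. y \<otimes>\<^bsub>R'\<^esub> (\<phi> f [^]\<^bsub>R'\<^esub> n) = \<phi> a) \<and>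
     (\<forall>a \<in> carrier R. \<phi> a = \<zero>\<^bsub>R'\<^esub> \<longrightarrow> (\<exists>n::nat. (f [^]\<^bsub>R\<^esub> n) \<otimes>\<^bsub>R\<^esub> a = \<zero>\<^bsub>R\<^esub>))"

text \<open>Compatibility of a family \<open>x i\<close> over \<open>R\<^sub>f\<^sub>i\<close> is tested on all rings receiving maps from
  \<open>R\<^sub>f\<^sub>i\<close> and \<open>R\<^sub>f\<^sub>j\<close> under \<open>R\<close>; the localisation of \<open>R\<close> at \<open>f\<^sub>i f\<^sub>j\<close> is the universal such ring.\<close>

definition zariski_sheaf :: "('u, 's) ring_fun \<Rightarrow> bool" where
  "zariski_sheaf X \<longleftrightarrow>
     (\<forall>R (n::nat) f Rf \<phi> x.
        cring R \<and> (\<forall>i<n. f i \<in> carrier R) \<and> genideal R (f ` {..<n}) = carrier R \<and>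
        (\<forall>i<n. is_localization R (f i) (Rf i) (\<phi> i)) \<and>
        (\<forall>i<n. x i \<in> pts X (Rf i)) \<and>
        (\<forall>i<n. \<forall>j<n. \<forall>T \<alpha> \<beta>. cring T \<and> \<alpha> \<in> ring_hom (Rf i) T \<and> \<beta> \<in> ring_hom (Rf j) T \<and>
            (\<forall>a \<in> carrier R. \<alpha> (\<phi> i a) = \<beta> (\<phi> j a))
          \<longrightarrow> res X (Rf i) T \<alpha> (x i) = res X (Rf j) T \<beta> (x j))
        \<longrightarrow> (\<exists>!y. y \<in> pts X R \<and> (\<forall>i<n. res X R (Rf i) (\<phi> i) y = x i)))"

text \<open>By Yoneda, \<open>u \<in> X(A)\<close> is a morphism \<open>Spec A \<rightarrow> X\<close>.  It is an open immersion if it is a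
  monomorphism onto an open subfunctor \<open>U\<close>: the pullback of \<open>U\<close> along any \<open>Spec R \<rightarrow> X\<close> is
  the complement of the closed subscheme defined by an ideal of \<open>R\<close>.\<close>

definition affine_open :: "('u, 's) ring_fun \<Rightarrow> 'u ring \<Rightarrow> 's \<Rightarrow> bool" where
  "affine_open X A u \<longleftrightarrow>
     cring A \<and> u \<in> pts X A \<and>
     (\<forall>R. cring R \<longrightarrow> inj_on (\<lambda>\<chi>. res X A R \<chi> u) (pts (Spec A) R)) \<and>
     (\<forall>R x. cring R \<and> x \<in> pts X R \<longrightarrow>
        (\<exists>I. ideal I R \<and>
           (\<forall>R' \<phi>. cring R' \<and> \<phi> \<in> ring_hom R R' \<longrightarrow>
              (res X R R' \<phi> x \<in> (\<lambda>\<chi>. res X A R' \<chi> u) ` pts (Spec A) R'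
                 \<longleftrightarrow> genideal R' (\<phi> ` I) = carrier R'))))"

definition affine_cover :: "('u, 's) ring_fun \<Rightarrow> ('u ring \<times> 's) set \<Rightarrow> bool" where
  "affine_cover X C \<longleftrightarrow>
     (\<forall>(A, u) \<in> C. affine_open X A u) \<and>
     (\<forall>K x. field K \<and> x \<in> pts X K \<longrightarrow> (\<exists>(A, u) \<in> C. \<exists>\<chi> \<in> pts (Spec A) K. res X A K \<chi> u = x))"

definition is_scheme :: "('u, 's) ring_fun \<Rightarrow> bool" where
  "is_scheme X \<longleftrightarrow> is_functor X \<and> zariski_sheaf X \<and> (\<exists>C. affine_cover X C)"

text \<open>Points of the underlying space are classes of field-valued points, two of them being
  equivalent if they agree over a common extension field.  The point is represented by its residue
  field \<open>\<kappa>(s)\<close> exactly when \<open>Spec k \<rightarrow> X\<close> is universal in its class.\<close>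

definition nonempty_scheme :: "('u, 's) ring_fun \<Rightarrow> bool" where
  "nonempty_scheme X \<longleftrightarrow> (\<exists>K. field K \<and> pts X K \<noteq> {})"

definition same_point :: "('u, 's) ring_fun \<Rightarrow> 'u ring \<Rightarrow> 's \<Rightarrow> 'u ring \<Rightarrow> 's \<Rightarrow> bool" where
  "same_point X K x K' x' \<longleftrightarrow>
     (\<exists>E \<alpha> \<beta>. field E \<and> \<alpha> \<in> ring_hom K E \<and> \<beta> \<in> ring_hom K' E \<and> res X K E \<alpha> x = res X K' E \<beta> x')"

definition residue_point :: "('u, 's) ring_fun \<Rightarrow> 'u ring \<Rightarrow> 's \<Rightarrow> bool" where
  "residue_point X k x \<longleftrightarrow>
     field k \<and> x \<in> pts X k \<and>
     (\<forall>K y. field K \<and> y \<in> pts X K \<and> same_point X k x K y \<longrightarrow>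
        (\<exists>!\<phi>. \<phi> \<in> pts (Spec k) K \<and> res X k K \<phi> x = y))"

definition p_nilpotent :: "nat \<Rightarrow> ('u, 's) ring_fun \<Rightarrow> bool" where
  "p_nilpotent p X \<longleftrightarrow>
     (\<exists>C. affine_cover X C \<and> (\<forall>(A, u) \<in> C. \<exists>n::nat. add_pow A (p ^ n) \<one>\<^bsub>A\<^esub> = \<zero>\<^bsub>A\<^esub>))"

section \<open>Tensor products and faithfully flat homomorphisms\<close>

definition linear_maps :: "'c ring \<Rightarrow> ('c, 'x) module \<Rightarrow> ('c, 'y) module \<Rightarrow> ('x \<Rightarrow> 'y) set" where
  "linear_maps R M N =
     {h \<in> carrier M \<rightarrow> carrier N.
        (\<forall>x \<in> carrier M. \<forall>y \<in> carrier M. h (x \<oplus>\<^bsub>M\<^esub> y) = h x \<oplus>\<^bsub>N\<^esub> h y) \<and>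
        (\<forall>a \<in> carrier R. \<forall>x \<in> carrier M. h (a \<odot>\<^bsub>M\<^esub> x) = a \<odot>\<^bsub>N\<^esub> h x)}"

definition tensor_relations ::
  "'c ring \<Rightarrow> ('c, 'a) module \<Rightarrow> ('c, 'b) module \<Rightarrow> ('a \<times> 'b \<Rightarrow>\<^sub>0 int) set" where
  "tensor_relations R A B =
     {frag_of (a \<oplus>\<^bsub>A\<^esub> a', b) - frag_of (a, b) - frag_of (a', b) | a a' b.
        a \<in> carrier A \<and> a' \<in> carrier A \<and> b \<in> carrier B} \<union>
     {frag_of (a, b \<oplus>\<^bsub>B\<^esub> b') - frag_of (a, b) - frag_of (a, b') | a b b'.
        a \<in> carrier A \<and> b \<in> carrier B \<and> b' \<in> carrier B} \<union>
     {frag_of (r \<odot>\<^bsub>A\<^esub> a, b) - frag_of (a, r \<odot>\<^bsub>B\<^esub> b) | r a b.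
        r \<in> carrier R \<and> a \<in> carrier A \<and> b \<in> carrier B}"

definition tensor_kernel ::
  "'c ring \<Rightarrow> ('c, 'a) module \<Rightarrow> ('c, 'b) module \<Rightarrow> ('a \<times> 'b \<Rightarrow>\<^sub>0 int) set" where
  "tensor_kernel R A B =
     generate (free_Abelian_group (carrier A \<times> carrier B)) (tensor_relations R A B)"

definition tensor_map ::
  "'c ring \<Rightarrow> ('c, 'a) module \<Rightarrow> ('c, 'b) module \<Rightarrow> ('d \<Rightarrow> 'a) \<Rightarrow> ('e \<Rightarrow> 'b)
     \<Rightarrow> ('d \<times> 'e \<Rightarrow>\<^sub>0 int) set \<Rightarrow> ('a \<times> 'b \<Rightarrow>\<^sub>0 int) set" where
  "tensor_map R A B f g X =
     tensor_kernel R A B <#>\<^bsub>free_Abelian_group (carrier A \<times> carrier B)\<^esub>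
       (frag_extend (\<lambda>(d, e). frag_of (f d, g e)) ` X)"

text \<open>Elements of the tensor product are cosets in the free abelian group on pairs.  The fields
  \<open>mult\<close> and \<open>one\<close> of a module record are not part of the module structure.\<close>

definition tensor ::
  "'c ring \<Rightarrow> ('c, 'a) module \<Rightarrow> ('c, 'b) module \<Rightarrow> ('c, ('a \<times> 'b \<Rightarrow>\<^sub>0 int) set) module" where
  "tensor R A B =
     (let Q = free_Abelian_group (carrier A \<times> carrier B) Mod tensor_kernel R A B in
      \<lparr>carrier = carrier Q, monoid.mult = undefined, one = undefined,
       ring.zero = one Q, add = monoid.mult Q,
       smult = (\<lambda>r. tensor_map R A B (\<lambda>a. r \<odot>\<^bsub>A\<^esub> a) id)\<rparr>)"

definition pure_tensor ::
  "'c ring \<Rightarrow> ('c, 'a) module \<Rightarrow> ('c, 'b) module \<Rightarrow> 'a \<Rightarrow> 'b \<Rightarrow> ('a \<times> 'b \<Rightarrow>\<^sub>0 int) set" where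
  "pure_tensor R A B a b =
     tensor_kernel R A B #>\<^bsub>free_Abelian_group (carrier A \<times> carrier B)\<^esub> frag_of (a, b)"

definition ring_as_module :: "'x ring \<Rightarrow> ('c \<Rightarrow> 'x \<Rightarrow> 'x) \<Rightarrow> ('c, 'x) module" where
  "ring_as_module B act =
     \<lparr>carrier = carrier B, monoid.mult = monoid.mult B, one = one B,
      ring.zero = ring.zero B, add = add B, smult = act\<rparr>"

definition flat_hom :: "'u ring \<Rightarrow> 'u ring \<Rightarrow> ('u \<Rightarrow> 'u) \<Rightarrow> bool" where
  "flat_hom A B \<psi> \<longleftrightarrow>
     cring A \<and> cring B \<and> \<psi> \<in> ring_hom A B \<and>
     (let B' = ring_as_module B (\<lambda>a b. \<psi> a \<otimes>\<^bsub>B\<^esub> b) in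
      \<forall>(N :: ('u, 'u) module) (N' :: ('u, 'u) module) h.
        Module.module A N \<and> Module.module A N' \<and> h \<in> linear_maps A N N' \<and> inj_on h (carrier N)
        \<longrightarrow> inj_on (tensor_map A N' B' h id) (carrier (tensor A N B')))"

definition faithfully_flat :: "'u ring \<Rightarrow> 'u ring \<Rightarrow> ('u \<Rightarrow> 'u) \<Rightarrow> bool" where
  "faithfully_flat A B \<psi> \<longleftrightarrow>
     flat_hom A B \<psi> \<and>
     (\<forall>P. primeideal P A \<longrightarrow> (\<exists>Q. primeideal Q B \<and> P = {a \<in> carrier A. \<psi> a \<in> Q}))"

section \<open>Witt vectors\<close>

text \<open>Integer polynomials in variables \<open>X\<^sub>i\<close> (\<open>Inl i\<close>) and \<open>Y\<^sub>i\<close> (\<open>Inr i\<close>).\<close>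

type_synonym witt_poly = "((nat + nat) \<Rightarrow>\<^sub>0 nat) \<Rightarrow>\<^sub>0 int"

definition wvar :: "nat + nat \<Rightarrow> witt_poly" where
  "wvar v = Poly_Mapping.single (Poly_Mapping.single v 1) 1"

definition ghost :: "nat \<Rightarrow> (nat \<Rightarrow> witt_poly) \<Rightarrow> nat \<Rightarrow> witt_poly" where
  "ghost p x n = (\<Sum>i\<le>n. of_nat (p ^ i) * x i ^ (p ^ (n - i)))"

text \<open>\<open>ghost_solve p g\<close> is the sequence with ghost components \<open>g\<close>.  For the sequences \<open>g\<close> used below the
  coefficientwise division is exact, by the classical integrality theorem of Witt.\<close>

fun ghost_solve :: "nat \<Rightarrow> (nat \<Rightarrow> witt_poly) \<Rightarrow> nat \<Rightarrow> witt_poly" where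
  "ghost_solve p g n =
     Poly_Mapping.map (\<lambda>c. c div int (p ^ n))
       (g n - (\<Sum>i<n. of_nat (p ^ i) * ghost_solve p g i ^ (p ^ (n - i))))"

declare ghost_solve.simps [simp del]

definition witt_add_poly :: "nat \<Rightarrow> nat \<Rightarrow> witt_poly" where
  "witt_add_poly p =
     ghost_solve p (\<lambda>n. ghost p (wvar \<circ> Inl) n + ghost p (wvar \<circ> Inr) n)"

definition witt_mult_poly :: "nat \<Rightarrow> nat \<Rightarrow> witt_poly" where
  "witt_mult_poly p =
     ghost_solve p (\<lambda>n. ghost p (wvar \<circ> Inl) n * ghost p (wvar \<circ> Inr) n)"

definition witt_frob_poly :: "nat \<Rightarrow> nat \<Rightarrow> witt_poly" where
  "witt_frob_poly p = ghost_solve p (\<lambda>n. ghost p (wvar \<circ> Inl) (Suc n))"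

definition weval :: "'u ring \<Rightarrow> (nat \<Rightarrow> 'u) \<Rightarrow> (nat \<Rightarrow> 'u) \<Rightarrow> witt_poly \<Rightarrow> 'u" where
  "weval R x y q =
     (\<Oplus>\<^bsub>R\<^esub> m \<in> Poly_Mapping.keys q.
        add_pow R (Poly_Mapping.lookup q m)
          (\<Otimes>\<^bsub>R\<^esub> v \<in> Poly_Mapping.keys m. case_sum x y v [^]\<^bsub>R\<^esub> Poly_Mapping.lookup m v))"

definition teichmueller :: "'u ring \<Rightarrow> 'u \<Rightarrow> nat \<Rightarrow> 'u" where
  "teichmueller R a = (\<lambda>n. if n = 0 then a else \<zero>\<^bsub>R\<^esub>)"

definition witt :: "nat \<Rightarrow> 'u ring \<Rightarrow> (nat \<Rightarrow> 'u) ring" where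
  "witt p R =
     \<lparr>carrier = {w. \<forall>n. w n \<in> carrier R},
      monoid.mult = (\<lambda>x y n. weval R x y (witt_mult_poly p n)),
      one = teichmueller R \<one>\<^bsub>R\<^esub>,
      ring.zero = (\<lambda>n. \<zero>\<^bsub>R\<^esub>),
      add = (\<lambda>x y n. weval R x y (witt_add_poly p n))\<rparr>"

definition witt_frob :: "nat \<Rightarrow> 'u ring \<Rightarrow> (nat \<Rightarrow> 'u) \<Rightarrow> nat \<Rightarrow> 'u" where
  "witt_frob p R w = (\<lambda>n. weval R w (\<lambda>_. \<zero>\<^bsub>R\<^esub>) (witt_frob_poly p n))"

text \<open>The projection \<open>W \<rightarrow> W\<^sub>n\<close>.\<close>

definition witt_trunc :: "nat \<Rightarrow> (nat \<Rightarrow> 'u) \<Rightarrow> nat \<Rightarrow> 'u" where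
  "witt_trunc n w = restrict w {..<n}"

section \<open>Modules over ring schemes\<close>

record ('u, 'c) ring_sch =
  rs_ring :: "'u ring \<Rightarrow> 'c ring"
  rs_map :: "('u \<Rightarrow> 'u) \<Rightarrow> 'c \<Rightarrow> 'c"

definition Ga :: "('u, 'u) ring_sch" where
  "Ga = \<lparr>rs_ring = (\<lambda>R. R), rs_map = (\<lambda>\<phi>. \<phi>)\<rparr>"

definition W :: "nat \<Rightarrow> ('u, nat \<Rightarrow> 'u) ring_sch" where
  "W p = \<lparr>rs_ring = witt p, rs_map = (\<lambda>\<phi> w. \<phi> \<circ> w)\<rparr>"

text \<open>A functor over \<open>S\<close> is given by its fibres \<open>fib R s\<close> over the points \<open>s \<in> S(R)\<close> and the
  maps \<open>tr R R' \<phi> s\<close> from the fibre over \<open>s\<close> to the fibre over the image of \<open>s\<close> in \<open>S(R')\<close>.\<close>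

record ('u, 's, 'c, 'x) mod_fun =
  fib :: "'u ring \<Rightarrow> 's \<Rightarrow> ('c, 'x) module"
  tr :: "'u ring \<Rightarrow> 'u ring \<Rightarrow> ('u \<Rightarrow> 'u) \<Rightarrow> 's \<Rightarrow> 'x \<Rightarrow> 'x"

definition is_mod_fun ::
  "('u, 'c) ring_sch \<Rightarrow> ('u, 's) ring_fun \<Rightarrow> ('u, 's, 'c, 'x) mod_fun \<Rightarrow> bool" where
  "is_mod_fun \<O> S M \<longleftrightarrow>
     (\<forall>R s. cring R \<and> s \<in> pts S R \<longrightarrow> Module.module (rs_ring \<O> R) (fib M R s)) \<and>
     (\<forall>R R' \<phi> s. cring R \<and> cring R' \<and> \<phi> \<in> ring_hom R R' \<and> s \<in> pts S R \<longrightarrow>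
        (let N = fib M R s; N' = fib M R' (res S R R' \<phi> s); t = tr M R R' \<phi> s in
         t \<in> carrier N \<rightarrow> carrier N' \<and>
         (\<forall>x \<in> carrier N. \<forall>y \<in> carrier N. t (x \<oplus>\<^bsub>N\<^esub> y) = t x \<oplus>\<^bsub>N'\<^esub> t y) \<and>
         (\<forall>a \<in> carrier (rs_ring \<O> R). \<forall>x \<in> carrier N. t (a \<odot>\<^bsub>N\<^esub> x) = rs_map \<O> \<phi> a \<odot>\<^bsub>N'\<^esub> t x))) \<and>
     (\<forall>R s. cring R \<and> s \<in> pts S R \<longrightarrow> (\<forall>x \<in> carrier (fib M R s). tr M R R id s x = x)) \<and>
     (\<forall>R R' R'' \<phi> \<psi> s. cring R \<and> cring R' \<and> cring R'' \<and> \<phi> \<in> ring_hom R R' \<and> \<psi> \<in> ring_hom R' R'' \<and>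
        s \<in> pts S R \<longrightarrow>
        (\<forall>x \<in> carrier (fib M R s).
           tr M R' R'' \<psi> (res S R R' \<phi> s) (tr M R R' \<phi> s x) = tr M R R'' (\<psi> \<circ> \<phi>) s x)) \<and>
     (\<forall>R R' \<phi> \<psi> s. cring R \<and> cring R' \<and> \<phi> \<in> ring_hom R R' \<and> \<psi> \<in> ring_hom R R' \<and> s \<in> pts S R \<and>
        (\<forall>a \<in> carrier R. \<phi> a = \<psi> a) \<longrightarrow>
        (\<forall>x \<in> carrier (fib M R s). tr M R R' \<phi> s x = tr M R R' \<psi> s x))"

text \<open>Affineness of \<open>M\<close> over \<open>S\<close>: the pullback of \<open>M\<close> along any \<open>s \<in> S(A)\<close> is represented by
  an \<open>A\<close>-algebra \<open>\<psi> : A \<rightarrow> B\<close> with universal point \<open>m\<close>.\<close>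

definition affine_over :: "('u, 's) ring_fun \<Rightarrow> ('u, 's, 'c, 'x) mod_fun \<Rightarrow> bool" where
  "affine_over S M \<longleftrightarrow>
     (\<forall>A s. cring A \<and> s \<in> pts S A \<longrightarrow>
        (\<exists>B \<psi> m. cring B \<and> \<psi> \<in> ring_hom A B \<and> m \<in> carrier (fib M B (res S A B \<psi> s)) \<and>
           (\<forall>R \<phi> x. cring R \<and> \<phi> \<in> ring_hom A R \<and> x \<in> carrier (fib M R (res S A R \<phi> s)) \<longrightarrow>
              (\<exists>!\<chi>. \<chi> \<in> pts (Spec B) R \<and> (\<forall>a \<in> carrier A. \<chi> (\<psi> a) = \<phi> a) \<and>
                    tr M B R \<chi> (res S A B \<psi> s) m = x))))"

definition module_scheme ::
  "('u, 'c) ring_sch \<Rightarrow> ('u, 's) ring_fun \<Rightarrow> ('u, 's, 'c, 'x) mod_fun \<Rightarrow> bool" where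
  "module_scheme \<O> S M \<longleftrightarrow> is_mod_fun \<O> S M \<and> affine_over S M"

definition mod_map ::
  "('u, 'c) ring_sch \<Rightarrow> ('u, 's) ring_fun \<Rightarrow> ('u, 's, 'c, 'x) mod_fun \<Rightarrow> ('u, 's, 'c, 'y) mod_fun
     \<Rightarrow> ('u ring \<Rightarrow> 's \<Rightarrow> 'x \<Rightarrow> 'y) \<Rightarrow> bool" where
  "mod_map \<O> S M N \<eta> \<longleftrightarrow>
     (\<forall>R s. cring R \<and> s \<in> pts S R \<longrightarrow> \<eta> R s \<in> linear_maps (rs_ring \<O> R) (fib M R s) (fib N R s)) \<and>
     (\<forall>R R' \<phi> s. cring R \<and> cring R' \<and> \<phi> \<in> ring_hom R R' \<and> s \<in> pts S R \<longrightarrow>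
        (\<forall>x \<in> carrier (fib M R s).
           \<eta> R' (res S R R' \<phi> s) (tr M R R' \<phi> s x) = tr N R R' \<phi> s (\<eta> R s x)))"

definition mod_iso ::
  "('u, 'c) ring_sch \<Rightarrow> ('u, 's) ring_fun \<Rightarrow> ('u, 's, 'c, 'x) mod_fun \<Rightarrow> ('u, 's, 'c, 'y) mod_fun
     \<Rightarrow> ('u ring \<Rightarrow> 's \<Rightarrow> 'x \<Rightarrow> 'y) \<Rightarrow> bool" where
  "mod_iso \<O> S M N \<eta> \<longleftrightarrow>
     mod_map \<O> S M N \<eta> \<and>
     (\<forall>R s. cring R \<and> s \<in> pts S R \<longrightarrow> bij_betw (\<eta> R s) (carrier (fib M R s)) (carrier (fib N R s)))"

text \<open>Pullback along \<open>t : Spec B \<rightarrow> S\<close>.\<close>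

definition pullback ::
  "('u, 's) ring_fun \<Rightarrow> 'u ring \<Rightarrow> 's \<Rightarrow> ('u, 's, 'c, 'x) mod_fun
     \<Rightarrow> ('u, 'u \<Rightarrow> 'u, 'c, 'x) mod_fun" where
  "pullback S B t M =
     \<lparr>fib = (\<lambda>R \<chi>. fib M R (res S B R \<chi> t)),
      tr = (\<lambda>R R' \<phi> \<chi>. tr M R R' \<phi> (res S B R \<chi> t))\<rparr>"

text \<open>Every fpqc covering of a scheme is refined by one consisting of an affine open covering
  \<open>Spec A\<^sub>i\<close> together with faithfully flat maps \<open>A\<^sub>i \<rightarrow> B\<^sub>i\<close>.\<close>

definition fpqc_loc_iso ::
  "('u, 'c) ring_sch \<Rightarrow> ('u, 's) ring_fun \<Rightarrow> ('u, 's, 'c, 'x) mod_fun \<Rightarrow> ('u, 's, 'c, 'y) mod_fun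
     \<Rightarrow> bool" where
  "fpqc_loc_iso \<O> S M N \<longleftrightarrow>
     (\<exists>C. affine_cover S C \<and>
        (\<forall>(A, u) \<in> C. \<exists>B \<psi>. faithfully_flat A B \<psi> \<and>
           (\<exists>\<eta>. mod_iso \<O> (Spec B) (pullback S B (res S A B \<psi> u) M)
                                   (pullback S B (res S A B \<psi> u) N) \<eta>)))"

definition zariski_loc_iso ::
  "('u, 'c) ring_sch \<Rightarrow> ('u, 's) ring_fun \<Rightarrow> ('u, 's, 'c, 'x) mod_fun \<Rightarrow> ('u, 's, 'c, 'y) mod_fun
     \<Rightarrow> bool" where
  "zariski_loc_iso \<O> S M N \<longleftrightarrow>
     (\<exists>C. affine_cover S C \<and>
        (\<forall>(A, u) \<in> C. \<exists>\<eta>. mod_iso \<O> (Spec A) (pullback S A u M) (pullback S A u N) \<eta>))"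

text \<open>Exactness of \<open>0 \<rightarrow> N \<rightarrow> M \<rightarrow> M' \<rightarrow> 0\<close> as fpqc sheaves.  Over an affine base, fpqc-local
  liftability means liftability after one faithfully flat extension.\<close>

definition short_exact ::
  "('u, 'c) ring_sch \<Rightarrow> ('u, 's) ring_fun \<Rightarrow>
     ('u, 's, 'c, 'x) mod_fun \<Rightarrow> ('u, 's, 'c, 'y) mod_fun \<Rightarrow> ('u, 's, 'c, 'z) mod_fun \<Rightarrow>
     ('u ring \<Rightarrow> 's \<Rightarrow> 'x \<Rightarrow> 'y) \<Rightarrow> ('u ring \<Rightarrow> 's \<Rightarrow> 'y \<Rightarrow> 'z) \<Rightarrow> bool" where
  "short_exact \<O> S N M M' \<iota> \<pi> \<longleftrightarrow>
     mod_map \<O> S N M \<iota> \<and> mod_map \<O> S M M' \<pi> \<and>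
     (\<forall>R s. cring R \<and> s \<in> pts S R \<longrightarrow>
        inj_on (\<iota> R s) (carrier (fib N R s)) \<and>
        \<iota> R s ` carrier (fib N R s) = {m \<in> carrier (fib M R s). \<pi> R s m = \<zero>\<^bsub>fib M' R s\<^esub>} \<and>
        (\<forall>y \<in> carrier (fib M' R s). \<exists>R' \<psi>. faithfully_flat R R' \<psi> \<and>
           (\<exists>m \<in> carrier (fib M R' (res S R R' \<psi> s)).
              \<pi> R' (res S R R' \<psi> s) m = tr M' R R' \<psi> s y)))"

section \<open>Admissible and invertible modules\<close>

definition Ga_mod :: "('u, 's, 'u, 'u) mod_fun" where
  "Ga_mod = \<lparr>fib = (\<lambda>R s. ring_as_module R (monoid.mult R)), tr = (\<lambda>R R' \<phi> s. \<phi>)\<rparr>"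

definition W_mod :: "nat \<Rightarrow> ('u, 's, nat \<Rightarrow> 'u, nat \<Rightarrow> 'u) mod_fun" where
  "W_mod p = \<lparr>fib = (\<lambda>R s. ring_as_module (witt p R) (monoid.mult (witt p R))),
              tr = (\<lambda>R R' \<phi> s w. \<phi> \<circ> w)\<rparr>"

text \<open>\<open>M\<^sup>(\<^sup>1\<^sup>)\<close>: the action is precomposed with \<open>F\<close>.\<close>

definition frob_twist ::
  "nat \<Rightarrow> ('u, 's, nat \<Rightarrow> 'u, 'x) mod_fun \<Rightarrow> ('u, 's, nat \<Rightarrow> 'u, 'x) mod_fun" where
  "frob_twist p M =
     M\<lparr>fib := (\<lambda>R s. (fib M R s)\<lparr>smult := (\<lambda>w x. witt_frob p R w \<odot>\<^bsub>fib M R s\<^esub> x)\<rparr>)\<rparr>"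

text \<open>\<open>W\<^sup>(\<^sup>F\<^sup>)(R) = Ker F\<close> as an \<open>R\<close>-module: \<open>W(R)\<close> acts through \<open>W(R)/V(W(R)) = R\<close>, so that \<open>a \<in> R\<close>
  acts as any of its lifts to \<open>W(R)\<close>, for instance the Teichmueller lift.\<close>

definition W_F :: "nat \<Rightarrow> 'u ring \<Rightarrow> ('u, nat \<Rightarrow> 'u) module" where
  "W_F p R =
     (ring_as_module (witt p R) (\<lambda>a w. teichmueller R a \<otimes>\<^bsub>witt p R\<^esub> w))
       \<lparr>carrier := {w \<in> carrier (witt p R). witt_frob p R w = \<zero>\<^bsub>witt p R\<^esub>}\<rparr>"

text \<open>A line bundle, regarded as a module over the ring scheme \<open>\<G>\<^sub>a\<close>.\<close>

definition line_bundle :: "('u, 's) ring_fun \<Rightarrow> ('u, 's, 'u, 'x) mod_fun \<Rightarrow> bool" where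
  "line_bundle S L \<longleftrightarrow> module_scheme Ga S L \<and> zariski_loc_iso Ga S L Ga_mod"

text \<open>\<open>L\<^sup>\<sharp> = L \<otimes> W\<^sup>(\<^sup>F\<^sup>)\<close>.  As \<open>L(R, s)\<close> is an invertible \<open>R\<close>-module compatible with base change, the
  presheaf tensor product is already an fpqc sheaf.  A Witt vector \<open>w\<close> acts through its
  component \<open>w 0\<close>, its image in \<open>\<G>\<^sub>a\<close>.\<close>

definition sharp ::
  "nat \<Rightarrow> ('u, 's) ring_fun \<Rightarrow> ('u, 's, 'u, 'x) mod_fun
     \<Rightarrow> ('u, 's, nat \<Rightarrow> 'u, ('x \<times> (nat \<Rightarrow> 'u) \<Rightarrow>\<^sub>0 int) set) mod_fun" where
  "sharp p S L =
     \<lparr>fib = (\<lambda>R s. let T = tensor R (fib L R s) (W_F p R) in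
               \<lparr>carrier = carrier T, monoid.mult = undefined, one = undefined,
                ring.zero = ring.zero T, add = add T, smult = (\<lambda>w x. w 0 \<odot>\<^bsub>T\<^esub> x)\<rparr>),
      tr = (\<lambda>R R' \<phi> s. tensor_map R' (fib L R' (res S R R' \<phi> s)) (W_F p R')
               (tr L R R' \<phi> s) (\<lambda>w. \<phi> \<circ> w))\<rparr>"

definition invertible_module ::
  "nat \<Rightarrow> ('u, 's) ring_fun \<Rightarrow> ('u, 's, nat \<Rightarrow> 'u, 'x) mod_fun \<Rightarrow> bool" where
  "invertible_module p S M \<longleftrightarrow> module_scheme (W p) S M \<and> fpqc_loc_iso (W p) S M (W_mod p)"

definition admissible_sequence ::
  "nat \<Rightarrow> ('u, 's) ring_fun \<Rightarrow> ('u, 's, nat \<Rightarrow> 'u, 'x) mod_fun \<Rightarrow>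
     ('u, 's, 'u, 'l) mod_fun \<Rightarrow> ('u, 's, nat \<Rightarrow> 'u, 'y) mod_fun \<Rightarrow>
     ('u ring \<Rightarrow> 's \<Rightarrow> ('l \<times> (nat \<Rightarrow> 'u) \<Rightarrow>\<^sub>0 int) set \<Rightarrow> 'x) \<Rightarrow> ('u ring \<Rightarrow> 's \<Rightarrow> 'x \<Rightarrow> 'y) \<Rightarrow> bool" where
  "admissible_sequence p S M L M' \<iota> \<pi> \<longleftrightarrow>
     line_bundle S L \<and>
     module_scheme (W p) S M' \<and> fpqc_loc_iso (W p) S M' (frob_twist p (W_mod p)) \<and>
     short_exact (W p) S (sharp p S L) M M' \<iota> \<pi>"

text \<open>The sections of an affine scheme over \<open>Spec R\<close> are functions on a representing
  ring, so \<open>'u \<Rightarrow> 'u\<close> is large enough to hold the sections of \<open>L\<close> and \<open>M'\<close>.\<close>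

definition admissible ::
  "nat \<Rightarrow> ('u, 's) ring_fun \<Rightarrow> ('u, 's, nat \<Rightarrow> 'u, 'x) mod_fun \<Rightarrow> bool" where
  "admissible p S M \<longleftrightarrow>
     module_scheme (W p) S M \<and>
     (\<exists>(L :: ('u, 's, 'u, 'u \<Rightarrow> 'u) mod_fun) (M' :: ('u, 's, nat \<Rightarrow> 'u, 'u \<Rightarrow> 'u) mod_fun) \<iota> \<pi>.
        admissible_sequence p S M L M' \<iota> \<pi>)"

section \<open>Primitive maps\<close>

text \<open>Global functions on a functor over \<open>S\<close>, i.e. morphisms to the affine line.\<close>

definition global_function ::
  "('u, 's) ring_fun \<Rightarrow> ('u, 's, 'c, 'x) mod_fun \<Rightarrow> ('u ring \<Rightarrow> 's \<Rightarrow> 'x \<Rightarrow> 'u) \<Rightarrow> bool" where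
  "global_function S M f \<longleftrightarrow>
     (\<forall>R s. cring R \<and> s \<in> pts S R \<longrightarrow> f R s \<in> carrier (fib M R s) \<rightarrow> carrier R) \<and>
     (\<forall>R R' \<phi> s. cring R \<and> cring R' \<and> \<phi> \<in> ring_hom R R' \<and> s \<in> pts S R \<longrightarrow>
        (\<forall>x \<in> carrier (fib M R s). f R' (res S R R' \<phi> s) (tr M R R' \<phi> s x) = \<phi> (f R s x)))"

definition nilpotent_function ::
  "('u, 's) ring_fun \<Rightarrow> ('u, 's, 'c, 'x) mod_fun \<Rightarrow> ('u ring \<Rightarrow> 's \<Rightarrow> 'x \<Rightarrow> 'u) \<Rightarrow> bool" where
  "nilpotent_function S M f \<longleftrightarrow>
     global_function S M f \<and>
     (\<exists>n::nat. \<forall>R s. cring R \<and> s \<in> pts S R \<longrightarrow>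
        (\<forall>x \<in> carrier (fib M R s). f R s x [^]\<^bsub>R\<^esub> n = \<zero>\<^bsub>R\<^esub>))"

text \<open>For \<open>M\<close> affine over affine \<open>S\<close>, so that \<open>M = Spec B\<close>, these are the points of the closed
  subscheme \<open>M\<^sub>r\<^sub>e\<^sub>d\<close> defined by the nilradical of \<open>B\<close>.\<close>

definition red_pts ::
  "('u, 's) ring_fun \<Rightarrow> ('u, 's, 'c, 'x) mod_fun \<Rightarrow> 'u ring \<Rightarrow> 's \<Rightarrow> 'x set" where
  "red_pts S M R s =
     {x \<in> carrier (fib M R s). \<forall>f. nilpotent_function S M f \<longrightarrow> f R s x = \<zero>\<^bsub>R\<^esub>}"

text \<open>\<open>(M\<^sub>s)\<^sub>r\<^sub>e\<^sub>d \<subseteq> Ker \<xi>\<^sub>n\<close> for the point \<open>s = (k, x)\<close>.\<close>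

definition red_in_kernel ::
  "nat \<Rightarrow> ('u, 's) ring_fun \<Rightarrow> ('u, 's, nat \<Rightarrow> 'u, 'x) mod_fun
     \<Rightarrow> ('u ring \<Rightarrow> 's \<Rightarrow> 'x \<Rightarrow> nat \<Rightarrow> 'u) \<Rightarrow> nat \<Rightarrow> 'u ring \<Rightarrow> 's \<Rightarrow> bool" where
  "red_in_kernel p S M \<xi> n k x \<longleftrightarrow>
     (\<forall>R \<chi>. cring R \<and> \<chi> \<in> pts (Spec k) R \<longrightarrow>
        (\<forall>m \<in> red_pts (Spec k) (pullback S k x M) R \<chi>.
           witt_trunc n (\<xi> R (res S k R \<chi> x) m) = witt_trunc n \<zero>\<^bsub>witt p R\<^esub>))"

definition primitive ::
  "nat \<Rightarrow> ('u, 's) ring_fun \<Rightarrow> ('u, 's, nat \<Rightarrow> 'u, 'x) mod_fun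
     \<Rightarrow> ('u ring \<Rightarrow> 's \<Rightarrow> 'x \<Rightarrow> nat \<Rightarrow> 'u) \<Rightarrow> bool" where
  "primitive p S M \<xi> \<longleftrightarrow>
     mod_map (W p) S M (W_mod p) \<xi> \<and>
     (\<forall>k x. residue_point S k x \<longrightarrow>
        red_in_kernel p S M \<xi> 1 k x \<and> \<not> red_in_kernel p S M \<xi> 2 k x)"

section \<open>The stack and its two substacks\<close>

text \<open>Objects over \<open>S\<close> only; the substacks below are full, hence determined by their objects.\<close>

type_synonym ('u, 's, 'x) sigma_obj =
  "('u, 's, nat \<Rightarrow> 'u, 'x) mod_fun \<times> ('u ring \<Rightarrow> 's \<Rightarrow> 'x \<Rightarrow> nat \<Rightarrow> 'u)"

definition Sigma' :: "nat \<Rightarrow> ('u, 's) ring_fun \<Rightarrow> ('u, 's, 'x) sigma_obj set" where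
  "Sigma' p S =
     (if p_nilpotent p S then {(M, \<xi>). admissible p S M \<and> primitive p S M \<xi>} else {})"

definition Sigma_plus :: "nat \<Rightarrow> ('u, 's) ring_fun \<Rightarrow> ('u, 's, 'x) sigma_obj set" where
  "Sigma_plus p S = {(M, \<xi>) \<in> Sigma' p S. invertible_module p S M}"

text \<open>\<open>\<xi>\<close> restricted to \<open>L\<^sup>\<sharp>\<close> is \<open>v\<^sup>\<sharp>\<close>, where \<open>O\<^sub>S\<^sup>\<sharp> = \<G>\<^sub>a \<otimes> W\<^sup>(\<^sup>F\<^sup>)\<close> is identified with
  \<open>W\<^sup>(\<^sup>F\<^sup>)\<close> by \<open>a \<otimes> w \<mapsto> a \<cdot> w\<close>; pure tensors generate \<open>L\<^sup>\<sharp>(R, s)\<close>.\<close>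

definition comes_from ::
  "nat \<Rightarrow> ('u, 's) ring_fun \<Rightarrow> ('u, 's, 'u, 'l) mod_fun \<Rightarrow>
     ('u ring \<Rightarrow> 's \<Rightarrow> ('l \<times> (nat \<Rightarrow> 'u) \<Rightarrow>\<^sub>0 int) set \<Rightarrow> 'x) \<Rightarrow>
     ('u ring \<Rightarrow> 's \<Rightarrow> 'x \<Rightarrow> nat \<Rightarrow> 'u) \<Rightarrow> ('u ring \<Rightarrow> 's \<Rightarrow> 'l \<Rightarrow> 'u) \<Rightarrow> bool" where
  "comes_from p S L \<iota> \<xi> v \<longleftrightarrow>
     mod_map Ga S L Ga_mod v \<and>
     (\<forall>R s. cring R \<and> s \<in> pts S R \<longrightarrow>
        (\<forall>l \<in> carrier (fib L R s). \<forall>w \<in> carrier (W_F p R).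
           \<xi> R s (\<iota> R s (pure_tensor R (fib L R s) (W_F p R) l w)) = v R s l \<odot>\<^bsub>W_F p R\<^esub> w))"

text \<open>The sequence is unique up to unique isomorphism and \<open>v\<close> is determined by it, so it does not
  matter for which sequence the condition is imposed.\<close>

definition Sigma_minus :: "nat \<Rightarrow> ('u, 's) ring_fun \<Rightarrow> ('u, 's, 'x) sigma_obj set" where
  "Sigma_minus p S =
     {(M, \<xi>) \<in> Sigma' p S.
        \<exists>(L :: ('u, 's, 'u, 'u \<Rightarrow> 'u) mod_fun) (M' :: ('u, 's, nat \<Rightarrow> 'u, 'u \<Rightarrow> 'u) mod_fun) \<iota> \<pi> v.
          admissible_sequence p S M L M' \<iota> \<pi> \<and> comes_from p S L \<iota> \<xi> v \<and>
          mod_iso Ga S L Ga_mod v}"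

end

theory Submission
  imports Defs "HOL-Algebra.Ring_Divisibility" "HOL-Algebra.Weak_Morphisms"
begin

text \<open>
  At a suitable point \<open>Spec K \<rightarrow> S\<close>, with \<open>K\<close> a field, an invertible \<open>M\<close> becomes free on a generator
  \<open>e \<in> M(K)\<close>, so \<open>\<xi>\<close> is multiplication by the Witt vector \<open>\<xi>(e)\<close>.  As \<open>e\<close> is a point with values in a
  field it lies on \<open>M\<^sub>r\<^sub>e\<^sub>d\<close>, and primitivity makes the zeroth component of \<open>\<xi>(e)\<close> vanish; hence so does the
  zeroth component of \<open>\<xi>\<close> on all of \<open>M\<^sub>K\<close>.  If \<open>v\<^sub>-\<close> were an isomorphism, then \<open>\<xi>\<close> would map
  \<open>L\<^sup>\<sharp>\<close> onto \<open>W\<^sup>(\<^sup>F\<^sup>)\<close>, which over the dual numbers \<open>K[\<epsilon>]\<close> contains the Teichmueller lift of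
  \<open>\<epsilon>\<close>, whose zeroth component is not zero.
\<close>

section \<open>Residue fields\<close>

text \<open>Zorn's lemma for the ideals above \<open>I\<close> that avoid one, a condition inherited
  by unions of nonempty chains.\<close>

lemma (in cring) exists_maximalideal:
  assumes I: "ideal I R" and one: "\<one> \<notin> I"
  shows "\<exists>J. maximalideal J R \<and> I \<subseteq> J"
proof -
  define A where "A = {J. ideal J R \<and> I \<subseteq> J \<and> \<one> \<notin> J}"
  have "\<exists>M\<in>A. \<forall>X\<in>A. M \<subseteq> X \<longrightarrow> X = M"
  proof (rule subset_Zorn_nonempty)
    show "A \<noteq> {}" using I one by (auto simp: A_def)
    fix C assume C: "C \<noteq> {}" "subset.chain A C"
    then have CA: "C \<subseteq> A" by (auto simp: pred_on.chain_def)
    have "subset.chain {J. ideal J R} C"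
      using C(2) by (auto simp: pred_on.chain_def A_def)
    from chain_Union_is_ideal[OF this] have "ideal (\<Union>C) R" using C(1) by simp
    then show "\<Union>C \<in> A" using CA C(1) by (fastforce simp: A_def)
  qed
  then obtain M where M: "ideal M R" "I \<subseteq> M" "\<one> \<notin> M"
    and max: "\<And>X. ideal X R \<Longrightarrow> M \<subseteq> X \<Longrightarrow> \<one> \<notin> X \<Longrightarrow> X = M"
    unfolding A_def by (smt (verit) mem_Collect_eq subset_trans)
  have "maximalideal M R"
  proof (rule maximalidealI[OF M(1)])
    show "carrier R \<noteq> M" using M(3) one_closed by blast
    show "J = M \<or> J = carrier R" if "ideal J R" "M \<subseteq> J" "J \<subseteq> carrier R" for J
      using max[OF that(1,2)] ideal.one_imp_carrier[OF that(1)] by blast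
  qed
  then show ?thesis using M by blast
qed

lemma restrict_ring_hom:
  assumes "ring R" "f \<in> ring_hom R T" shows "restrict f (carrier R) \<in> ring_hom R T"
proof -
  interpret ring R by fact
  show ?thesis using assms(2) by (auto simp: ring_hom_def)
qed

text \<open>The residue field is modelled on a set of representatives, so as to remain on the type of \<open>R\<close>.\<close>

lemma (in cring) residue_field:
  assumes "maximalideal Q R"
  shows "\<exists>(K :: 'a ring) f. field K \<and> f \<in> ring_hom R K \<and> f \<in> extensional (carrier R) \<and>
    f ` carrier R = carrier K \<and> (\<forall>a \<in> carrier R. f a = \<zero>\<^bsub>K\<^esub> \<longleftrightarrow> a \<in> Q)"
proof -
  interpret Q: maximalideal Q R by fact
  \<comment> \<open>The chosen representative depends only on the coset of \<open>a\<close>, so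
    \<open>g\<close> identifies exactly the elements congruent modulo \<open>Q\<close>, and
    \<open>image_ring g R\<close> is a copy of the quotient by \<open>Q\<close>.\<close>
  define g where "g a = (SOME b. b \<in> Q +> a)" for a
  have g_in: "g a \<in> Q +> a" if "a \<in> carrier R" for a
    unfolding g_def using Q.a_rcos_self[OF that] by (rule someI)
  have g_iff: "g a = g b \<longleftrightarrow> a \<ominus> b \<in> Q" if "a \<in> carrier R" "b \<in> carrier R" for a b
  proof
    assume "g a = g b"
    then have "g a \<in> Q +> a" "g a \<in> Q +> b" using g_in that by metis+
    then have "Q +> a = Q +> b" using Q.a_repr_independence' that by metis
    then show "a \<ominus> b \<in> Q" using quotient_eq_iff_same_a_r_cos[OF Q.ideal_axioms that] by simp
  next
    assume "a \<ominus> b \<in> Q"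
    then show "g a = g b" using quotient_eq_iff_same_a_r_cos[OF Q.ideal_axioms that] g_def by simp
  qed
  then have w: "weak_ring_morphism g Q R" by (intro weak_ring_morphismI Q.ideal_axioms)
  let ?K = "image_ring g R"
  have F: "field ?K" using image_ring_is_field[OF w Q.quotient_is_field] is_cring by simp
  have hom: "g \<in> ring_hom R ?K" by (rule weak_ring_morphism_is_hom[OF w])
  have z: "g a = \<zero>\<^bsub>?K\<^esub> \<longleftrightarrow> a \<in> Q" if "a \<in> carrier R" for a
    unfolding image_ring_zero using g_iff[OF that zero_closed] that by (simp add: minus_eq)
  show ?thesis
    by (rule exI[of _ ?K], rule exI[of _ "restrict g (carrier R)"])
      (use F hom z restrict_ring_hom[OF ring_axioms] in \<open>auto simp: image_ring_carrier\<close>)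
qed

text \<open>The universal property of a quotient, with \<open>k\<close> in the role of
  \<open>A\<close> modulo the kernel of \<open>f\<close>: lift along \<open>f\<close>, apply \<chi>,
  and let \<open>ker\<close> remove the dependence on the lift. The result is extensional, as a
  point of \<open>Spec k\<close> must be.\<close>

lemma ring_hom_factor:
  assumes A: "cring A" and k: "cring k" and f: "f \<in> ring_hom A k" and surj: "f ` carrier A = carrier k"
    and \<chi>: "\<chi> \<in> ring_hom A T"
    and ker: "\<And>a b. a \<in> carrier A \<Longrightarrow> b \<in> carrier A \<Longrightarrow> f a = f b \<Longrightarrow> \<chi> a = \<chi> b"
  obtains h where "h \<in> pts (Spec k) T" "\<And>a. a \<in> carrier A \<Longrightarrow> h (f a) = \<chi> a"
proof -
  interpret A: cring A by fact
  interpret k: cring k by fact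
  define h where "h = restrict (\<lambda>c. \<chi> (inv_into (carrier A) f c)) (carrier k)"
  have hf: "h (f a) = \<chi> a" if "a \<in> carrier A" for a
  proof -
    let ?a = "inv_into (carrier A) f (f a)"
    have "f a \<in> f ` carrier A" using that by blast
    then have a: "?a \<in> carrier A" "f ?a = f a"
      by (auto intro: inv_into_into f_inv_into_f)
    have "h (f a) = \<chi> ?a" using ring_hom_closed[OF f that] by (simp add: h_def)
    also have "\<dots> = \<chi> a" by (rule ker[OF a(1) that a(2)])
    finally show ?thesis .
  qed
  have "h \<in> ring_hom k T"
  proof (rule ring_hom_memI)
    show "h x \<in> carrier T" if "x \<in> carrier k" for x
      using that hf \<chi> unfolding surj[symmetric] by (auto simp: ring_hom_closed)
    show "h \<one>\<^bsub>k\<^esub> = \<one>\<^bsub>T\<^esub>"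
      using hf[OF A.one_closed] ring_hom_one[OF f] ring_hom_one[OF \<chi>] by simp
    fix x y assume "x \<in> carrier k" "y \<in> carrier k"
    then obtain a b where ab: "a \<in> carrier A" "b \<in> carrier A" "x = f a" "y = f b"
      unfolding surj[symmetric] by blast
    then show "h (x \<otimes>\<^bsub>k\<^esub> y) = h x \<otimes>\<^bsub>T\<^esub> h y"
      using hf[OF A.m_closed[OF ab(1,2)]] hf ring_hom_mult[OF f] ring_hom_mult[OF \<chi>] by metis
    show "h (x \<oplus>\<^bsub>k\<^esub> y) = h x \<oplus>\<^bsub>T\<^esub> h y"
      using ab hf[OF A.a_closed[OF ab(1,2)]] hf ring_hom_add[OF f] ring_hom_add[OF \<chi>] by metis
  qed
  then show thesis using hf by (intro that[of h]) (auto simp: Spec_def h_def)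
qed

section \<open>Points of schemes\<close>

lemma res_res:
  assumes "is_functor X" "cring A" "cring B" "cring C" "\<phi> \<in> ring_hom A B" "\<psi> \<in> ring_hom B C" "x \<in> pts X A"
  shows "res X B C \<psi> (res X A B \<phi> x) = res X A C (\<psi> \<circ> \<phi>) x"
  using assms unfolding is_functor_def by blast

lemma res_cong:
  assumes "is_functor X" "cring A" "cring B" "\<phi> \<in> ring_hom A B" "\<psi> \<in> ring_hom A B" "x \<in> pts X A"
    "\<And>a. a \<in> carrier A \<Longrightarrow> \<phi> a = \<psi> a"
  shows "res X A B \<phi> x = res X A B \<psi> x"
  using assms unfolding is_functor_def by blast

lemma res_closed:
  assumes "is_functor X" "cring A" "cring B" "\<phi> \<in> ring_hom A B" "x \<in> pts X A"
  shows "res X A B \<phi> x \<in> pts X B"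
  using assms unfolding is_functor_def by blast

lemma pts_Spec: "\<chi> \<in> pts (Spec A) R \<longleftrightarrow> \<chi> \<in> ring_hom A R \<and> \<chi> \<in> extensional (carrier A)"
  by (auto simp: Spec_def)

lemma restrict_pts_Spec:
  assumes "cring A" "\<chi> \<in> ring_hom A R" shows "restrict \<chi> (carrier A) \<in> pts (Spec A) R"
  using restrict_ring_hom[OF cring.axioms(1)] assms by (auto simp: pts_Spec)

text \<open>A field has only two ideals, and the zero ideal extends to the zero ideal of
  \<open>E\<close>. Geometrically, a field-valued point that lies in an open subfunctor after a
  field extension already lies in it.\<close>

lemma (in field) genideal_unit_imp:
  assumes "ideal I R" "field E" "\<beta> \<in> ring_hom R E" "genideal E (\<beta> ` I) = carrier E"
  shows "I = carrier R"
proof (rule ccontr)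
  interpret E: field E by fact
  interpret h: ring_hom_ring R E \<beta>
    by (rule ring_hom_ringI2[OF ring_axioms E.ring_axioms assms(3)])
  assume "I \<noteq> carrier R"
  then have "I = {\<zero>}" using assms(1) all_ideals by blast
  then have "genideal E (\<beta> ` I) = {\<zero>\<^bsub>E\<^esub>}" using E.genideal_zero by simp
  then show False using assms(4) E.one_closed E.one_not_zero by auto
qed

text \<open>The surjectivity of \<open>A \<rightarrow> k\<close> says that the point is closed in \<open>Spec A\<close>.\<close>

lemma residue_point_of_affine_open:
  assumes X: "is_functor X" and u: "affine_open X A u" and k: "field k"
    and f: "f \<in> ring_hom A k" and surj: "f ` carrier A = carrier k"
  shows "residue_point X k (res X A k f u)"
  unfolding residue_point_def
proof (intro conjI allI impI)
  interpret k: field k by fact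
  have A: "cring A" and uA: "u \<in> pts X A" using u by (auto simp: affine_open_def)
  interpret A: cring A by fact
  have inj: "\<And>\<chi> \<chi>' R. cring R \<Longrightarrow> \<chi> \<in> pts (Spec A) R \<Longrightarrow> \<chi>' \<in> pts (Spec A) R
      \<Longrightarrow> res X A R \<chi> u = res X A R \<chi>' u \<Longrightarrow> \<chi> = \<chi>'"
    using u unfolding affine_open_def inj_on_def by blast
  \<comment> \<open>Composites of homomorphisms are rarely extensional, so the monomorphism property
    is first transferred to arbitrary homomorphisms, which it determines on the carrier.\<close>
  have inj': "\<chi> a = \<chi>' a"
    if "cring R" "\<chi> \<in> ring_hom A R" "\<chi>' \<in> ring_hom A R" "res X A R \<chi> u = res X A R \<chi>' u" "a \<in> carrier A"
    for \<chi> \<chi>' R a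
  proof -
    have "res X A R (restrict \<chi> (carrier A)) u = res X A R \<chi> u"
      by (rule res_cong[OF X A]) (use that uA restrict_ring_hom[OF A.ring_axioms] in auto)
    moreover have "res X A R (restrict \<chi>' (carrier A)) u = res X A R \<chi>' u"
      by (rule res_cong[OF X A]) (use that uA restrict_ring_hom[OF A.ring_axioms] in auto)
    ultimately have "restrict \<chi> (carrier A) = restrict \<chi>' (carrier A)"
      using inj[OF that(1)] restrict_pts_Spec[OF A] that by metis
    then show ?thesis using that(5) by (metis restrict_apply')
  qed
  show "field k" by fact
  show "res X A k f u \<in> pts X k" using res_closed[OF X A k.is_cring f uA] .
  fix K y
  assume y: "field K \<and> y \<in> pts X K \<and> same_point X k (res X A k f u) K y"
  then interpret K: field K by blast
  have yK: "y \<in> pts X K" using y by blast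
  obtain E \<alpha> \<beta> where E: "field E" "\<alpha> \<in> ring_hom k E" "\<beta> \<in> ring_hom K E"
    and eq: "res X k E \<alpha> (res X A k f u) = res X K E \<beta> y"
    using y unfolding same_point_def by blast
  interpret E: field E by fact
  have af: "\<alpha> \<circ> f \<in> ring_hom A E" by (rule ring_hom_trans[OF f E(2)])
  have eq': "res X A E (\<alpha> \<circ> f) u = res X K E \<beta> y"
    using eq res_res[OF X A k.is_cring E.is_cring f E(2) uA] by simp
  \<comment> \<open>\<open>I\<close> describes the part of \<open>Spec K\<close> lying over the
    affine open. Over \<open>E\<close> the point \<open>y\<close> agrees with a point coming from
    \<open>A\<close>, so \<open>I\<close> extends to the unit ideal there; hence \<open>I\<close> is
    all of \<open>K\<close>, and \<open>y\<close> itself is given by some \<chi> on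
    \<open>A\<close>.\<close>
  obtain I where I: "ideal I K" and iff: "\<And>R' \<phi>. cring R' \<Longrightarrow> \<phi> \<in> ring_hom K R' \<Longrightarrow>
      res X K R' \<phi> y \<in> (\<lambda>\<chi>. res X A R' \<chi> u) ` pts (Spec A) R' \<longleftrightarrow> genideal R' (\<phi> ` I) = carrier R'"
    using u K.is_cring yK unfolding affine_open_def by metis
  have "res X A E (restrict (\<alpha> \<circ> f) (carrier A)) u = res X A E (\<alpha> \<circ> f) u"
    by (rule res_cong[OF X A E.is_cring]) (use af uA restrict_ring_hom[OF A.ring_axioms] in auto)
  then have "res X K E \<beta> y \<in> (\<lambda>\<chi>. res X A E \<chi> u) ` pts (Spec A) E"
    using eq' restrict_pts_Spec[OF A af] by (metis image_eqI)
  then have "genideal E (\<beta> ` I) = carrier E" using iff[OF E.is_cring E(3)] by blast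
  then have "I = carrier K" using K.genideal_unit_imp[OF I E(1,3)] by blast
  then have "genideal K (id ` I) = carrier K"
    using K.genideal_self[of "carrier K"] K.genideal_ideal[of "carrier K"]
      ideal.Icarr by fastforce
  then have "res X K K id y \<in> (\<lambda>\<chi>. res X A K \<chi> u) ` pts (Spec A) K"
    using iff[OF K.is_cring, of id] by (simp add: id_ring_hom)
  moreover have "res X K K id y = y" using X K.is_cring yK unfolding is_functor_def by blast
  ultimately obtain \<chi> where \<chi>: "\<chi> \<in> pts (Spec A) K" "y = res X A K \<chi> u" by auto
  have \<chi>h: "\<chi> \<in> ring_hom A K" using \<chi> by (simp add: pts_Spec)
  have "res X A E (\<beta> \<circ> \<chi>) u = res X A E (\<alpha> \<circ> f) u"
    using res_res[OF X A K.is_cring E.is_cring \<chi>h E(3) uA] \<chi>(2) eq' by simp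
  then have comm: "\<beta> (\<chi> a) = \<alpha> (f a)" if "a \<in> carrier A" for a
    using inj'[OF E.is_cring ring_hom_trans[OF \<chi>h E(3)] af _ that] by simp
  \<comment> \<open>\<beta> is injective as a homomorphism of fields, so equality of \<chi>-values
    can be tested in \<open>E\<close>, where they are \<alpha> applied to values of
    \<open>f\<close>.\<close>
  have ker: "\<chi> a = \<chi> b" if "a \<in> carrier A" "b \<in> carrier A" "f a = f b" for a b
    using non_trivial_field_hom_is_inj[OF E(3) K.field_axioms E(1)] comm that ring_hom_closed[OF \<chi>h]
    unfolding inj_on_def by metis
  obtain h where h: "h \<in> pts (Spec k) K" "\<And>a. a \<in> carrier A \<Longrightarrow> h (f a) = \<chi> a"
    using ring_hom_factor[OF A k.is_cring f surj \<chi>h ker] by blast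
  have hh: "h \<in> ring_hom k K" using h by (simp add: pts_Spec)
  show "\<exists>!\<phi>. \<phi> \<in> pts (Spec k) K \<and> res X k K \<phi> (res X A k f u) = y"
  proof (rule ex1I[of _ h])
    have "res X k K h (res X A k f u) = res X A K (h \<circ> f) u"
      by (rule res_res[OF X A k.is_cring K.is_cring f hh uA])
    also have "\<dots> = y" unfolding \<chi>(2)
      by (rule res_cong[OF X A K.is_cring ring_hom_trans[OF f hh] \<chi>h uA]) (simp add: h)
    finally show "h \<in> pts (Spec k) K \<and> res X k K h (res X A k f u) = y" using h by blast
    fix \<phi> assume \<phi>: "\<phi> \<in> pts (Spec k) K \<and> res X k K \<phi> (res X A k f u) = y"
    then have \<phi>h: "\<phi> \<in> ring_hom k K" by (simp add: pts_Spec)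
    have "res X A K (\<phi> \<circ> f) u = res X A K \<chi> u"
      using res_res[OF X A k.is_cring K.is_cring f \<phi>h uA] \<phi> \<chi>(2) by simp
    \<comment> \<open>Uniqueness: the monomorphism property fixes the composite with
      \<open>f\<close>, and \<open>f\<close> is onto.\<close>
    then have "\<phi> (f a) = \<chi> a" if "a \<in> carrier A" for a
      using inj'[OF K.is_cring ring_hom_trans[OF f \<phi>h] \<chi>h _ that] by simp
    then have "\<phi> c = h c" if "c \<in> carrier k" for c
      using that h(2) unfolding surj[symmetric] by auto
    then show "\<phi> = h"
      using \<phi> h(1) by (intro extensionalityI[of _ "carrier k"]) (auto simp: pts_Spec)
  qed
qed

section \<open>Witt vectors\<close>

text \<open>At index zero the recursion subtracts an empty sum and divides by \<open>p ^ 0\<close>,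
  leaving the product of the two zeroth ghost components.\<close>

lemma witt_mult_poly_0:
  "witt_mult_poly p 0 =
     Poly_Mapping.single (Poly_Mapping.single (Inl 0) 1 + Poly_Mapping.single (Inr 0) 1) 1"
proof -
  have map_id: "Poly_Mapping.map (\<lambda>c. c) q = q" for q :: witt_poly
    by (rule poly_mapping_eqI) (simp add: map.rep_eq when_def)
  show ?thesis
    unfolding witt_mult_poly_def
    by (subst ghost_solve.simps) (simp add: ghost_def wvar_def mult_single map_id)
qed

text \<open>The multiplicativity of the projection from \<open>W\<close> to \<open>Ga\<close>: a
  Witt vector with zeroth component zero keeps it under multiplication.\<close>

lemma witt_mult_0:
  fixes R :: "'a ring" (structure)
  assumes "cring R" "x 0 \<in> carrier R" "y 0 \<in> carrier R"
  shows "(x \<otimes>\<^bsub>witt p R\<^esub> y) 0 = x 0 \<otimes> y 0"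
proof -
  interpret cring R by fact
  let ?m = "Poly_Mapping.single (Inl 0) 1 + Poly_Mapping.single (Inr 0) 1 :: (nat + nat) \<Rightarrow>\<^sub>0 nat"
  have l: "Poly_Mapping.lookup ?m (Inl 0) = 1" "Poly_Mapping.lookup ?m (Inr 0) = 1"
    by (simp_all add: lookup_add lookup_single when_def)
  have "Poly_Mapping.keys ?m = {Inl 0, Inr 0}"
    by (auto simp: in_keys_iff lookup_add lookup_single when_def split: if_splits)
  then have "(\<Otimes>v \<in> Poly_Mapping.keys ?m. case_sum x y v [^] Poly_Mapping.lookup ?m v) = x 0 \<otimes> y 0"
    using assms by (simp del: One_nat_def add: l nat_pow_eone)
  then show ?thesis
    using assms by (simp add: witt_def weval_def witt_mult_poly_0)
qed

text \<open>The ideal of polynomials whose monomials all vanish at \<open>X\<^sub>0 = r\<close>, with the other variables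
  zero, as soon as \<open>r\<^sup>2 = 0\<close>.\<close>

definition no_linear :: "witt_poly \<Rightarrow> bool" where
  "no_linear q \<longleftrightarrow> 0 \<notin> Poly_Mapping.keys q \<and> Poly_Mapping.single (Inl 0) 1 \<notin> Poly_Mapping.keys q"

lemma no_linear_zero: "no_linear 0" by (simp add: no_linear_def)

lemma no_linear_add: "no_linear a \<Longrightarrow> no_linear b \<Longrightarrow> no_linear (a + b)"
  using keys_add[of a b] by (auto simp: no_linear_def)

lemma no_linear_diff: "no_linear a \<Longrightarrow> no_linear b \<Longrightarrow> no_linear (a - b)"
  using keys_diff[of a b] by (auto simp: no_linear_def)

lemma no_linear_sum: "(\<And>i. i \<in> I \<Longrightarrow> no_linear (f i)) \<Longrightarrow> no_linear (sum f I)"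
  by (induction I rule: infinite_finite_induct) (auto simp: no_linear_zero no_linear_add)

text \<open>Read multiplicatively on monomials, this is the irreducibility of a variable.\<close>

lemma add_eq_single_one:
  fixes a b :: "'a \<Rightarrow>\<^sub>0 nat"
  assumes "a + b = Poly_Mapping.single v 1"
  shows "b = 0 \<or> b = Poly_Mapping.single v 1"
proof -
  have ab: "Poly_Mapping.lookup a x + Poly_Mapping.lookup b x = (1 when v = x)" for x
    using assms[THEN arg_cong[of _ _ "\<lambda>q. Poly_Mapping.lookup q x"]]
    by (simp add: lookup_add lookup_single)
  consider "Poly_Mapping.lookup b v = 0" | "Poly_Mapping.lookup b v = 1" using ab[of v] by fastforce
  then show ?thesis
  proof cases
    case 1
    have "Poly_Mapping.lookup b x = 0" for x using ab[of x] 1 by (cases "v = x") auto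
    then show ?thesis by (auto intro: poly_mapping_eqI)
  next
    case 2
    have "Poly_Mapping.lookup b x = (1 when v = x)" for x using ab[of x] 2 by (cases "v = x") auto
    then have "b = Poly_Mapping.single v 1" by (intro poly_mapping_eqI) (simp add: lookup_single)
    then show ?thesis by simp
  qed
qed

text \<open>A monomial of the product is one of \<open>a\<close> times one of \<open>b\<close>. If
  it were 1 or the zeroth variable, its factor from \<open>b\<close> would be one of these two as
  well.\<close>

lemma no_linear_mult:
  assumes "no_linear b" shows "no_linear (a * b)"
proof -
  have "m \<in> {0, Poly_Mapping.single (Inl 0) 1} \<Longrightarrow> m = c + d \<Longrightarrow> d \<in> {0, Poly_Mapping.single (Inl 0) 1}"
    for m c d :: "(nat + nat) \<Rightarrow>\<^sub>0 nat"
  proof (elim insertE)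
    assume "m = 0" "m = c + d"
    then have "Poly_Mapping.lookup c x + Poly_Mapping.lookup d x = 0" for x
      by (metis lookup_add lookup_zero)
    then show "d \<in> {0, Poly_Mapping.single (Inl 0) 1}" by (auto intro: poly_mapping_eqI)
  qed (use add_eq_single_one in force)+
  then show ?thesis using keys_mult[of a b] assms unfolding no_linear_def by blast
qed

lemma no_linear_power:
  assumes "no_linear a" "n > 0" shows "no_linear (a ^ n)"
  using assms(2)
proof (cases n)
  case (Suc m)
  then show ?thesis using no_linear_mult[OF assms(1), of "a ^ m"] by (simp add: power_commutes)
qed simp

lemma no_linear_map_div: "no_linear q \<Longrightarrow> no_linear (Poly_Mapping.map (\<lambda>c. c div d) q)"
  by (auto simp: no_linear_def in_keys_iff map.rep_eq when_def)

text \<open>By strong induction: the recursion subtracts multiples of positive powers of earlier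
  terms, and coefficientwise division creates no new monomials.\<close>

lemma no_linear_ghost_solve:
  assumes "p > 0" "\<And>n. no_linear (g n)"
  shows "no_linear (ghost_solve p g n)"
proof (induction n rule: less_induct)
  case (less n)
  show ?case
    unfolding ghost_solve.simps[of p g n]
    by (intro no_linear_map_div no_linear_diff assms no_linear_sum no_linear_mult no_linear_power less)
      (use assms in auto)
qed

lemma wvar_power: "wvar v ^ n = Poly_Mapping.single (Poly_Mapping.single v n) 1"
  by (induction n) (simp_all add: wvar_def mult_single flip: single_add)

text \<open>The shift to \<open>Suc n\<close> is decisive: in that ghost component the zeroth
  variable has exponent \<open>p ^ Suc n\<close>, at least 2, whereas the ghost component of index 0
  is the zeroth variable itself.\<close>

lemma no_linear_frob:
  assumes "p \<ge> 2" shows "no_linear (witt_frob_poly p n)"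
  unfolding witt_frob_poly_def
proof (rule no_linear_ghost_solve)
  show "p > 0" using assms by simp
  show "no_linear (ghost p (wvar \<circ> Inl) (Suc n))" for n
    unfolding ghost_def
  proof (intro no_linear_sum no_linear_mult)
    fix i assume i: "i \<in> {..Suc n}"
    have e: "p ^ (Suc n - i) > 0" using assms by simp
    have "i = 0 \<Longrightarrow> p ^ (Suc n - i) > 1" using assms one_less_power[of p "Suc n"] by simp
    then have "Poly_Mapping.single (Inl i :: nat + nat) (p ^ (Suc n - i)) \<noteq> Poly_Mapping.single (Inl 0) 1"
      using e by (auto dest!: arg_cong[of _ _ "\<lambda>q. Poly_Mapping.lookup q (Inl i)"] simp: lookup_single when_def split: if_splits)
    moreover have "Poly_Mapping.single (Inl i :: nat + nat) (p ^ (Suc n - i)) \<noteq> 0"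
      using e by (metis lookup_single_eq lookup_zero less_irrefl)
    ultimately show "no_linear ((wvar \<circ> Inl) i ^ p ^ (Suc n - i))"
      by (simp add: no_linear_def wvar_power)
  qed
qed

text \<open>Each monomial of \<open>q\<close> either contains a variable evaluated at zero or is a
  power of the zeroth variable with exponent at least 2, which vanishes since \<open>r\<close>
  squares to zero.\<close>

lemma weval_no_linear:
  fixes R :: "'a ring" (structure)
  assumes "cring R" and r: "r \<in> carrier R" "r \<otimes> r = \<zero>" and q: "no_linear q"
  shows "weval R (teichmueller R r) (\<lambda>_. \<zero>) q = \<zero>"
proof -
  interpret cring R by fact
  let ?c = "case_sum (teichmueller R r) (\<lambda>_. \<zero>)"
  have c: "?c v \<in> carrier R" for v using r by (cases v) (auto simp: teichmueller_def)
  have "(\<Otimes>v \<in> Poly_Mapping.keys m. ?c v [^] Poly_Mapping.lookup m v) = \<zero>"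
    if "m \<in> Poly_Mapping.keys q" for m
  proof -
    have m: "m \<noteq> 0" "m \<noteq> Poly_Mapping.single (Inl 0) 1" using that q by (auto simp: no_linear_def)
    have "\<exists>v \<in> Poly_Mapping.keys m. ?c v [^] Poly_Mapping.lookup m v = \<zero>"
    proof (cases "Poly_Mapping.keys m \<subseteq> {Inl 0}")
      case True
      then have "Poly_Mapping.keys m = {Inl 0}" using m(1) by (metis keys_eq_empty subset_singletonD)
      then have k: "Inl 0 \<in> Poly_Mapping.keys m" by simp
      have s: "m = Poly_Mapping.single (Inl 0) (Poly_Mapping.lookup m (Inl 0))"
      proof (rule poly_mapping_eqI)
        fix v
        have "Poly_Mapping.lookup m v = 0" if "v \<noteq> Inl 0"
          using that True by (meson in_keys_iff singletonD subsetD)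
        then show "Poly_Mapping.lookup m v
            = Poly_Mapping.lookup (Poly_Mapping.single (Inl 0) (Poly_Mapping.lookup m (Inl 0))) v"
          by (cases "v = Inl 0") (simp_all add: lookup_single)
      qed
      have "Poly_Mapping.lookup m (Inl 0) \<noteq> 0" "Poly_Mapping.lookup m (Inl 0) \<noteq> 1"
        using k s m(2) by (auto simp only: in_keys_iff)
      then obtain j where "Poly_Mapping.lookup m (Inl 0) = Suc (Suc j)"
        by (metis One_nat_def not0_implies_Suc)
      then have "?c (Inl 0) [^] Poly_Mapping.lookup m (Inl 0) = \<zero>"
        using r by (simp add: teichmueller_def m_assoc)
      then show ?thesis using k by blast
    next
      case False
      then obtain v where v: "v \<in> Poly_Mapping.keys m" "v \<noteq> Inl 0" by blast
      then have "?c v = \<zero>" by (cases v) (auto simp: teichmueller_def)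
      then show ?thesis using v by (auto simp: in_keys_iff intro!: bexI[of _ v] nat_pow_zero)
    qed
    then obtain v where v: "v \<in> Poly_Mapping.keys m" "?c v [^] Poly_Mapping.lookup m v = \<zero>" by blast
    have "(\<Otimes>v \<in> insert v (Poly_Mapping.keys m - {v}). ?c v [^] Poly_Mapping.lookup m v)
        = \<zero> \<otimes> (\<Otimes>v \<in> Poly_Mapping.keys m - {v}. ?c v [^] Poly_Mapping.lookup m v)"
      using v(2) by (subst finprod_insert) (use c in auto)
    also have "\<dots> = \<zero>" by (intro l_null finprod_closed) (use c in auto)
    finally show ?thesis using v(1) by (simp add: insert_absorb)
  qed
  then have "weval R (teichmueller R r) (\<lambda>_. \<zero>) q = (\<Oplus>m \<in> Poly_Mapping.keys q. \<zero>)"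
    unfolding weval_def by (intro finsum_cong') (auto simp: add.int_pow_one)
  then show ?thesis by simp
qed

text \<open>This provides elements of the Frobenius kernel whose zeroth component is a prescribed
  square-zero element.\<close>

lemma teichmueller_in_W_F:
  fixes R :: "'a ring" (structure)
  assumes "cring R" "p \<ge> 2" "r \<in> carrier R" "r \<otimes> r = \<zero>"
  shows "teichmueller R r \<in> carrier (W_F p R)"
proof -
  interpret cring R by fact
  have "witt_frob p R (teichmueller R r) = (\<lambda>n. \<zero>)"
    using weval_no_linear[OF assms(1,3,4) no_linear_frob[OF assms(2)]] by (simp add: witt_frob_def)
  then show ?thesis using assms(3) by (simp add: W_F_def witt_def teichmueller_def)
qed

section \<open>Dual numbers\<close>

text \<open>The pair \<open>(a, b)\<close> stands for a + b \<epsilon>, where \<epsilon> squares to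
  zero.\<close>

definition dual_numbers :: "'a ring \<Rightarrow> ('a \<times> 'a) ring" where
  "dual_numbers K =
     \<lparr>carrier = carrier K \<times> carrier K,
      monoid.mult = (\<lambda>(a, b) (c, d). (a \<otimes>\<^bsub>K\<^esub> c, a \<otimes>\<^bsub>K\<^esub> d \<oplus>\<^bsub>K\<^esub> b \<otimes>\<^bsub>K\<^esub> c)),
      one = (\<one>\<^bsub>K\<^esub>, \<zero>\<^bsub>K\<^esub>), ring.zero = (\<zero>\<^bsub>K\<^esub>, \<zero>\<^bsub>K\<^esub>),
      add = (\<lambda>(a, b) (c, d). (a \<oplus>\<^bsub>K\<^esub> c, b \<oplus>\<^bsub>K\<^esub> d))\<rparr>"

lemma cring_dual_numbers:
  fixes R :: "'a ring" (structure)
  assumes "cring R" shows "cring (dual_numbers R)"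
proof -
  interpret cring R by fact
  show ?thesis
  proof (rule cringI)
    show "abelian_group (dual_numbers R)"
    proof (rule abelian_groupI)
      fix x assume "x \<in> carrier (dual_numbers R)"
      then show "\<exists>y\<in>carrier (dual_numbers R). y \<oplus>\<^bsub>dual_numbers R\<^esub> x = \<zero>\<^bsub>dual_numbers R\<^esub>"
        by (intro bexI[of _ "(\<ominus> fst x, \<ominus> snd x)"]) (auto simp: dual_numbers_def l_neg)
    qed (auto simp: dual_numbers_def a_ac)
    show "Group.comm_monoid (dual_numbers R)"
      by (rule comm_monoidI) (auto simp: dual_numbers_def m_ac a_ac l_distr r_distr)
  qed (auto simp: dual_numbers_def a_ac l_distr)
qed

text \<open>The dual numbers live on pairs, while the site only has rings on the type
  \<open>'a\<close>. An infinite type is in bijection with its square, so the structure is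
  transported along \<open>e\<close>; \<open>r\<close> is the image of \<epsilon>.\<close>

lemma exists_square_zero_extension:
  fixes K :: "'a ring"
  assumes "infinite (UNIV :: 'a set)" "field K"
  obtains T :: "'a ring" and j r where "cring T" "j \<in> ring_hom K T" "r \<in> carrier T"
    "r \<noteq> \<zero>\<^bsub>T\<^esub>" "r \<otimes>\<^bsub>T\<^esub> r = \<zero>\<^bsub>T\<^esub>"
proof -
  interpret K: field K by fact
  obtain e :: "'a \<times> 'a \<Rightarrow> 'a" where e: "bij e"
    using card_of_Times_same_infinite[OF assms(1)]
      card_of_ordIso[of "UNIV :: ('a \<times> 'a) set" "UNIV :: 'a set"]
    by (auto simp: UNIV_Times_UNIV)
  let ?D = "dual_numbers K"
  let ?T = "image_ring e ?D"
  interpret D: cring ?D by (rule cring_dual_numbers[OF K.is_cring])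
  have iso: "e \<in> ring_iso ?D ?T"
    by (rule inj_imp_image_ring_iso) (rule inj_on_subset[OF bij_is_inj[OF e] subset_UNIV])
  then have hom: "e \<in> ring_hom ?D ?T" by (simp add: ring_iso_def)
  have zero: "\<zero>\<^bsub>?T\<^esub> = e \<zero>\<^bsub>?D\<^esub>" by (rule image_ring_zero)
  have T: "cring ?T" using D.ring_iso_imp_img_cring[OF iso] by (simp add: zero[symmetric])
  have eps: "(\<zero>\<^bsub>K\<^esub>, \<one>\<^bsub>K\<^esub>) \<in> carrier ?D" by (simp add: dual_numbers_def)
  have inc: "(\<lambda>a. (a, \<zero>\<^bsub>K\<^esub>)) \<in> ring_hom K ?D"
    by (rule ring_hom_memI) (auto simp: dual_numbers_def)
  show thesis
  proof (rule that[OF T ring_hom_trans[OF inc hom] ring_hom_closed[OF hom eps]])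
    show "e (\<zero>\<^bsub>K\<^esub>, \<one>\<^bsub>K\<^esub>) \<noteq> \<zero>\<^bsub>?T\<^esub>"
      unfolding zero inj_eq[OF bij_is_inj[OF e]] by (simp add: dual_numbers_def)
    have "e (\<zero>\<^bsub>K\<^esub>, \<one>\<^bsub>K\<^esub>) \<otimes>\<^bsub>?T\<^esub> e (\<zero>\<^bsub>K\<^esub>, \<one>\<^bsub>K\<^esub>)
        = e ((\<zero>\<^bsub>K\<^esub>, \<one>\<^bsub>K\<^esub>) \<otimes>\<^bsub>?D\<^esub> (\<zero>\<^bsub>K\<^esub>, \<one>\<^bsub>K\<^esub>))"
      using ring_hom_mult[OF hom eps eps] by simp
    then show "e (\<zero>\<^bsub>K\<^esub>, \<one>\<^bsub>K\<^esub>) \<otimes>\<^bsub>?T\<^esub> e (\<zero>\<^bsub>K\<^esub>, \<one>\<^bsub>K\<^esub>) = \<zero>\<^bsub>?T\<^esub>"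
      unfolding zero by (simp add: dual_numbers_def)
  qed
qed

section \<open>Modules over the Witt vectors\<close>

lemma pure_tensor_closed:
  assumes "a \<in> carrier A" "b \<in> carrier B"
  shows "pure_tensor R A B a b \<in> carrier (tensor R A B)"
  using assms by (auto simp: tensor_def Let_def pure_tensor_def FactGroup_def RCOSETS_def)

lemma linear_mapsD:
  assumes "h \<in> linear_maps R M N"
  shows "x \<in> carrier M \<Longrightarrow> h x \<in> carrier N"
    and "a \<in> carrier R \<Longrightarrow> x \<in> carrier M \<Longrightarrow> h (a \<odot>\<^bsub>M\<^esub> x) = a \<odot>\<^bsub>N\<^esub> h x"
  using assms by (auto simp: linear_maps_def)

lemma mod_map_linear:
  assumes "mod_map \<O> S M N \<eta>" "cring R" "s \<in> pts S R"
  shows "\<eta> R s \<in> linear_maps (rs_ring \<O> R) (fib M R s) (fib N R s)"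
  using assms by (auto simp: mod_map_def)

lemma mod_map_natural:
  assumes "mod_map \<O> S M N \<eta>" "cring R" "cring R'" "\<phi> \<in> ring_hom R R'" "s \<in> pts S R"
    "x \<in> carrier (fib M R s)"
  shows "\<eta> R' (res S R R' \<phi> s) (tr M R R' \<phi> s x) = tr N R R' \<phi> s (\<eta> R s x)"
  using assms unfolding mod_map_def by blast

lemma tr_closed:
  assumes "is_mod_fun \<O> S M" "cring R" "cring R'" "\<phi> \<in> ring_hom R R'" "s \<in> pts S R"
    "x \<in> carrier (fib M R s)"
  shows "tr M R R' \<phi> s x \<in> carrier (fib M R' (res S R R' \<phi> s))"
proof -
  have "tr M R R' \<phi> s \<in> carrier (fib M R s) \<rightarrow> carrier (fib M R' (res S R R' \<phi> s))"
    using assms(1)[unfolded is_mod_fun_def Let_def, THEN conjunct2, THEN conjunct1] assms(2-5) by simp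
  then show ?thesis using assms(6) by blast
qed

text \<open>Nilpotent functions vanish at points with values in a field, so all of these lie on \<open>M\<^sub>r\<^sub>e\<^sub>d\<close>.\<close>

lemma primitive_at_field_point:
  assumes \<xi>: "primitive p S M \<xi>" and k: "residue_point S k x" and K: "field K"
    and h: "h \<in> pts (Spec k) K" and m: "m \<in> carrier (fib M K (res S k K h x))"
  shows "\<xi> K (res S k K h x) m 0 = \<zero>\<^bsub>K\<^esub>"
proof -
  interpret K: field K by fact
  have "m \<in> red_pts (Spec k) (pullback S k x M) K h"
    unfolding red_pts_def
  proof (intro CollectI conjI allI impI)
    show mf: "m \<in> carrier (fib (pullback S k x M) K h)" using m by (simp add: pullback_def)
    fix f assume f: "nilpotent_function (Spec k) (pullback S k x M) f"
    then have fK: "f K h m \<in> carrier K"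
      using mf h K.is_cring unfolding nilpotent_function_def global_function_def by blast
    obtain n :: nat where "f K h m [^]\<^bsub>K\<^esub> n = \<zero>\<^bsub>K\<^esub>"
      using f mf h K.is_cring unfolding nilpotent_function_def by blast
    then show "f K h m = \<zero>\<^bsub>K\<^esub>"
      by (induction n) (use fK K.integral in auto)
  qed
  moreover have "red_in_kernel p S M \<xi> 1 k x" using \<xi> k by (auto simp: primitive_def)
  ultimately have "witt_trunc 1 (\<xi> K (res S k K h x) m) = witt_trunc 1 \<zero>\<^bsub>witt p K\<^esub>"
    using h K.is_cring unfolding red_in_kernel_def by blast
  then have "witt_trunc 1 (\<xi> K (res S k K h x) m) 0 = witt_trunc 1 \<zero>\<^bsub>witt p K\<^esub> 0" by simp
  then show ?thesis by (simp add: witt_trunc_def witt_def)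
qed

text \<open>\<open>K\<close> is a residue field of \<open>B\<close>, for \<open>Spec B \<rightarrow> S\<close> a trivialising flat covering, at a point over
  a closed point of an affine open subscheme.\<close>

lemma invertible_module_generator:
  fixes S :: "('u, 's) ring_fun" and M :: "('u, 's, nat \<Rightarrow> 'u, 'x) mod_fun"
  assumes X: "is_functor S" and M: "invertible_module p S M" and ne: "nonempty_scheme S"
  obtains k x K h e where "residue_point S k x" "field K" "h \<in> pts (Spec k) K"
    "e \<in> carrier (fib M K (res S k K h x))"
    "\<And>R j m. \<lbrakk>cring R; j \<in> ring_hom K R; m \<in> carrier (fib M R (res S K R j (res S k K h x)))\<rbrakk> \<Longrightarrow>
       \<exists>b \<in> carrier (witt p R). m =
         b \<odot>\<^bsub>fib M R (res S K R j (res S k K h x))\<^esub> tr M K R j (res S k K h x) e"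
proof -
  obtain K\<^sub>0 x\<^sub>0 where K0: "field K\<^sub>0" "x\<^sub>0 \<in> pts S K\<^sub>0" using ne by (auto simp: nonempty_scheme_def)
  have Mm: "is_mod_fun (W p) S M" using M by (simp add: invertible_module_def module_scheme_def)
  obtain C where C: "affine_cover S C" and loc: "\<And>A u. (A, u) \<in> C \<Longrightarrow> \<exists>B \<psi>. faithfully_flat A B \<psi> \<and>
      (\<exists>\<eta>. mod_iso (W p) (Spec B) (pullback S B (res S A B \<psi> u) M)
                                   (pullback S B (res S A B \<psi> u) (W_mod p)) \<eta>)"
    using M unfolding invertible_module_def fpqc_loc_iso_def by fast
  obtain A u \<chi> where Au: "(A, u) \<in> C" and \<chi>: "\<chi> \<in> pts (Spec A) K\<^sub>0"
    using C K0 unfolding affine_cover_def by fast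
  have u: "affine_open S A u" using C Au by (auto simp: affine_cover_def)
  then have A: "cring A" and uA: "u \<in> pts S A" by (auto simp: affine_open_def)
  obtain B \<psi> \<eta> where ff: "faithfully_flat A B \<psi>" and
    \<eta>: "mod_iso (W p) (Spec B) (pullback S B (res S A B \<psi> u) M) (pullback S B (res S A B \<psi> u) (W_mod p)) \<eta>"
    using loc[OF Au] by blast
  have B: "cring B" and \<psi>: "\<psi> \<in> ring_hom A B" using ff by (auto simp: faithfully_flat_def flat_hom_def)
  interpret A: cring A by fact
  interpret B: cring B by fact
  \<comment> \<open>The given point of \<open>S\<close> serves only to find a chart with nonzero
    ring. It is then replaced by a closed point \<open>P\<close>, whose residue field is a quotient
    of \<open>A\<close>.\<close>
  have "\<one>\<^bsub>A\<^esub> \<noteq> \<zero>\<^bsub>A\<^esub>"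
  proof
    interpret K0: field K\<^sub>0 by fact
    interpret ring_hom_ring A K\<^sub>0 \<chi>
      by (rule ring_hom_ringI2[OF A.ring_axioms K0.ring_axioms]) (use \<chi> in \<open>simp add: pts_Spec\<close>)
    assume "\<one>\<^bsub>A\<^esub> = \<zero>\<^bsub>A\<^esub>"
    then show False using hom_one hom_zero K0.one_not_zero by metis
  qed
  then obtain P where P: "maximalideal P A" using A.exists_maximalideal[OF A.zeroideal] by auto
  obtain k :: "'u ring" and f where k: "field k" and f: "f \<in> ring_hom A k" "f ` carrier A = carrier k"
    and fP: "\<forall>a \<in> carrier A. f a = \<zero>\<^bsub>k\<^esub> \<longleftrightarrow> a \<in> P"
    using A.residue_field[OF P] by blast
  interpret k: field k by fact
  \<comment> \<open>Faithful flatness provides a prime over \<open>P\<close>. It is enlarged to a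
    maximal ideal \<open>Q\<close> so that its residue field is a quotient of \<open>B\<close>; the
    preimage of \<open>Q\<close> still contains \<open>P\<close>, which makes the map from
    \<open>A\<close> to \<open>K\<close> factor through \<open>k\<close>.\<close>
  obtain Q\<^sub>0 where Q0: "primeideal Q\<^sub>0 B" "P = {a \<in> carrier A. \<psi> a \<in> Q\<^sub>0}"
    using ff A.maximalideal_prime[OF P] unfolding faithfully_flat_def by blast
  interpret Q0: primeideal Q\<^sub>0 B by fact
  have "\<one>\<^bsub>B\<^esub> \<notin> Q\<^sub>0" using Q0.one_imp_carrier Q0.I_notcarr by blast
  then obtain Q where Q: "maximalideal Q B" "Q\<^sub>0 \<subseteq> Q" using B.exists_maximalideal[OF Q0.ideal_axioms] by blast
  obtain K :: "'u ring" and g where K: "field K" and g: "g \<in> ring_hom B K" "g \<in> extensional (carrier B)"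
    and gQ: "\<forall>b \<in> carrier B. g b = \<zero>\<^bsub>K\<^esub> \<longleftrightarrow> b \<in> Q"
    using B.residue_field[OF Q(1)] by blast
  interpret K: field K by fact
  have g\<psi>: "g \<circ> \<psi> \<in> ring_hom A K" by (rule ring_hom_trans[OF \<psi> g(1)])
  interpret f: ring_hom_ring A k f by (rule ring_hom_ringI2[OF A.ring_axioms k.ring_axioms f(1)])
  interpret g\<psi>: ring_hom_ring A K "g \<circ> \<psi>" by (rule ring_hom_ringI2[OF A.ring_axioms K.ring_axioms g\<psi>])
  have ker: "(g \<circ> \<psi>) a = (g \<circ> \<psi>) b" if ab: "a \<in> carrier A" "b \<in> carrier A" "f a = f b" for a b
  proof -
    have "f (a \<ominus>\<^bsub>A\<^esub> b) = \<zero>\<^bsub>k\<^esub>" using ab by (simp add: a_minus_def k.r_neg)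
    then have "a \<ominus>\<^bsub>A\<^esub> b \<in> P" using fP ab by simp
    then have "\<psi> (a \<ominus>\<^bsub>A\<^esub> b) \<in> Q" using Q0(2) Q(2) by blast
    then have "(g \<circ> \<psi>) (a \<ominus>\<^bsub>A\<^esub> b) = \<zero>\<^bsub>K\<^esub>" using gQ ring_hom_closed[OF \<psi>] ab by simp
    then have "(g \<circ> \<psi>) a \<ominus>\<^bsub>K\<^esub> (g \<circ> \<psi>) b = \<zero>\<^bsub>K\<^esub>"
      using ab by (simp only: a_minus_def g\<psi>.hom_add g\<psi>.hom_a_inv A.a_inv_closed)
    then show ?thesis using K.r_right_minus_eq g\<psi>.hom_closed ab by metis
  qed
  obtain h where h: "h \<in> pts (Spec k) K" "\<And>a. a \<in> carrier A \<Longrightarrow> h (f a) = (g \<circ> \<psi>) a"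
    using ring_hom_factor[OF A k.is_cring f g\<psi> ker] by blast
  have hh: "h \<in> ring_hom k K" using h by (simp add: pts_Spec)
  define x where "x = res S A k f u"
  define v where "v = res S A B \<psi> u"
  define t where "t = res S k K h x"
  have v: "v \<in> pts S B" unfolding v_def by (rule res_closed[OF X A B \<psi> uA])
  \<comment> \<open>The point \<open>t\<close> is reached in two ways: through \<open>k\<close>,
    where primitivity applies, and through \<open>B\<close>, where \<open>M\<close> is
    trivialised.\<close>
  have "t = res S A K (h \<circ> f) u"
    unfolding t_def x_def by (rule res_res[OF X A k.is_cring K.is_cring f(1) hh uA])
  also have "\<dots> = res S A K (g \<circ> \<psi>) u"
    by (rule res_cong[OF X A K.is_cring ring_hom_trans[OF f(1) hh] g\<psi> uA]) (simp add: h)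
  also have "\<dots> = res S B K g v"
    unfolding v_def by (rule res_res[OF X A B K.is_cring \<psi> g(1) uA, symmetric])
  finally have t: "t = res S B K g v" .
  have gp: "g \<in> pts (Spec B) K" using g by (simp add: pts_Spec)
  have tK: "t \<in> pts S K" unfolding t by (rule res_closed[OF X B K.is_cring g(1) v])
  have \<eta>map: "mod_map (W p) (Spec B) (pullback S B v M) (pullback S B v (W_mod p)) \<eta>"
    and \<eta>bij: "\<And>R s. cring R \<Longrightarrow> s \<in> pts (Spec B) R \<Longrightarrow>
       bij_betw (\<eta> R s) (carrier (fib M R (res S B R s v))) (carrier (witt p R))"
    using \<eta> unfolding mod_iso_def v_def[symmetric]
    by (auto simp: pullback_def W_mod_def ring_as_module_def)
  have "teichmueller K \<one>\<^bsub>K\<^esub> \<in> carrier (witt p K)" by (auto simp: witt_def teichmueller_def)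
  \<comment> \<open>The generator corresponds to the unit of \<open>W(K)\<close> under the
    trivialisation \<eta>.\<close>
  then obtain e where e: "e \<in> carrier (fib M K t)" "\<eta> K g e = teichmueller K \<one>\<^bsub>K\<^esub>"
    using \<eta>bij[OF K.is_cring gp] unfolding t bij_betw_def by (metis (no_types) imageE)
  have gen: "\<exists>b \<in> carrier (witt p R). m = b \<odot>\<^bsub>fib M R (res S K R j t)\<^esub> tr M K R j t e"
    if R: "cring R" and j: "j \<in> ring_hom K R" and m: "m \<in> carrier (fib M R (res S K R j t))" for R j m
  proof -
    interpret R: cring R by fact
    interpret j: ring_hom_ring K R j by (rule ring_hom_ringI2[OF K.ring_axioms R.ring_axioms j])
    define s where "s = restrict (j \<circ> g) (carrier B)"
    have jg: "j \<circ> g \<in> ring_hom B R" by (rule ring_hom_trans[OF g(1) j])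
    have s: "s \<in> pts (Spec B) R" unfolding s_def by (rule restrict_pts_Spec[OF B jg])
    have tR: "res S K R j t = res S B R s v"
      unfolding t res_res[OF X B K.is_cring R g(1) j v]
      by (rule res_cong[OF X B R jg _ v]) (use s in \<open>auto simp: pts_Spec s_def\<close>)
    have sres: "res (Spec B) K R j g = s" by (simp add: Spec_def s_def)
    have sp: "res S K R j t \<in> pts S R" by (rule res_closed[OF X K.is_cring R j tK])
    \<comment> \<open>The module axioms include those of a commutative ring for
      \<open>witt p R\<close>, which supply the unit law needed below.\<close>
    interpret Mod: Module.module "witt p R" "fib M R (res S K R j t)"
      using Mm R sp unfolding is_mod_fun_def by (simp add: W_def)
    let ?e = "tr M K R j t e"
    have eR: "?e \<in> carrier (fib M R (res S K R j t))" by (rule tr_closed[OF Mm K.is_cring R j tK e(1)])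
    have "\<eta> R s ?e = j \<circ> \<eta> K g e"
      using mod_map_natural[OF \<eta>map K.is_cring R j gp] e(1) unfolding sres
      by (simp add: pullback_def W_mod_def t)
    also have "\<dots> = \<one>\<^bsub>witt p R\<^esub>" unfolding e(2) by (auto simp: witt_def teichmueller_def)
    finally have \<eta>e: "\<eta> R s ?e = \<one>\<^bsub>witt p R\<^esub>" .
    \<comment> \<open>By naturality the restriction of \<open>e\<close> still corresponds to one, so
      the coefficient of \<open>m\<close> is its image under \<eta>.\<close>
    let ?b = "\<eta> R s m"
    have lin: "\<eta> R s \<in> linear_maps (witt p R) (fib M R (res S K R j t)) (ring_as_module (witt p R) (monoid.mult (witt p R)))"
      using mod_map_linear[OF \<eta>map R s] by (simp add: pullback_def W_mod_def W_def tR)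
    have b: "?b \<in> carrier (witt p R)" using linear_mapsD(1)[OF lin m] by (simp add: ring_as_module_def)
    have "\<eta> R s (?b \<odot>\<^bsub>fib M R (res S K R j t)\<^esub> ?e) = ?b \<otimes>\<^bsub>witt p R\<^esub> \<one>\<^bsub>witt p R\<^esub>"
      using linear_mapsD(2)[OF lin b eR] by (simp add: ring_as_module_def \<eta>e)
    then have "\<eta> R s (?b \<odot>\<^bsub>fib M R (res S K R j t)\<^esub> ?e) = \<eta> R s m" using b by simp
    then have "m = ?b \<odot>\<^bsub>fib M R (res S K R j t)\<^esub> ?e"
      using \<eta>bij[OF R s] m Mod.smult_closed[OF b eR] unfolding tR bij_betw_def by (metis inj_onD)
    then show ?thesis using b by blast
  qed
  show thesis
  proof (rule that)
    show "residue_point S k x" unfolding x_def by (rule residue_point_of_affine_open[OF X u k f])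
  qed (use K h(1) e(1) gen in \<open>simp_all add: t_def\<close>)
qed

section \<open>The contradiction over a square-zero extension of \<open>K\<close>\<close>

theorem lemma5p6p3:
  fixes S :: "('u, 's) ring_fun" and p :: nat
  assumes "infinite (UNIV :: 'u set)"
    and "Factorial_Ring.prime p"
    and "is_scheme S"
    and "nonempty_scheme S"
  shows "(Sigma_plus p S :: ('u, 's, 'x) sigma_obj set) \<inter> Sigma_minus p S = {}"
proof (rule equals0I)
  fix obj :: "('u, 's, 'x) sigma_obj"
  assume "obj \<in> Sigma_plus p S \<inter> Sigma_minus p S"
  moreover obtain M \<xi> where "obj = (M, \<xi>)" by (cases obj)
  ultimately have plus: "(M, \<xi>) \<in> Sigma_plus p S" and minus: "(M, \<xi>) \<in> Sigma_minus p S" by auto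
  then have inv: "invertible_module p S M" and prim: "primitive p S M \<xi>"
    by (auto simp: Sigma_plus_def Sigma'_def split: if_splits)
  obtain L :: "('u, 's, 'u, 'u \<Rightarrow> 'u) mod_fun" and M' :: "('u, 's, nat \<Rightarrow> 'u, 'u \<Rightarrow> 'u) mod_fun"
    and \<iota> \<pi> v where adm: "admissible_sequence p S M L M' \<iota> \<pi>"
    and cf: "comes_from p S L \<iota> \<xi> v" and iso: "mod_iso Ga S L Ga_mod v"
    using minus unfolding Sigma_minus_def by blast
  have X: "is_functor S" using assms(3) by (simp add: is_scheme_def)
  have Mm: "is_mod_fun (W p) S M" using inv by (simp add: invertible_module_def module_scheme_def)
  have \<xi>: "mod_map (W p) S M (W_mod p) \<xi>" using prim by (simp add: primitive_def)
  have \<iota>: "mod_map (W p) S (sharp p S L) M \<iota>"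
    using adm by (simp add: admissible_sequence_def short_exact_def)
  obtain k x K h e where kx: "residue_point S k x" and K: "field K" and h: "h \<in> pts (Spec k) K"
    and e: "e \<in> carrier (fib M K (res S k K h x))"
    and gen: "\<And>R j m. \<lbrakk>cring R; j \<in> ring_hom K R; m \<in> carrier (fib M R (res S K R j (res S k K h x)))\<rbrakk> \<Longrightarrow>
       \<exists>b \<in> carrier (witt p R). m =
         b \<odot>\<^bsub>fib M R (res S K R j (res S k K h x))\<^esub> tr M K R j (res S k K h x) e"
    using invertible_module_generator[OF X inv assms(4)] by blast
  interpret K: field K by fact
  define t where "t = res S k K h x"
  have tK: "t \<in> pts S K"
    unfolding t_def using kx h
    by (intro res_closed[OF X _ K.is_cring]) (auto simp: residue_point_def pts_Spec fieldE(1))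
  obtain R :: "'u ring" and j r where R: "cring R" and j: "j \<in> ring_hom K R" and r: "r \<in> carrier R" "r \<noteq> \<zero>\<^bsub>R\<^esub>"
    "r \<otimes>\<^bsub>R\<^esub> r = \<zero>\<^bsub>R\<^esub>"
    using exists_square_zero_extension[OF assms(1) K] by blast
  interpret R: cring R by fact
  interpret j: ring_hom_ring K R j by (rule ring_hom_ringI2[OF K.ring_axioms R.ring_axioms j])
  define s where "s = res S K R j t"
  have s: "s \<in> pts S R" unfolding s_def by (rule res_closed[OF X K.is_cring R j tK])
  \<comment> \<open>As \<open>v\<close> is bijective over \<open>R\<close>, some \<open>l\<close>
    maps to one; then \<xi> sends the image in \<open>M\<close> of the pure tensor of
    \<open>l\<close> and \<open>w\<close> to \<open>w\<close> multiplied by the unit Witt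
    vector.\<close>
  have "\<one>\<^bsub>R\<^esub> \<in> v R s ` carrier (fib L R s)"
    using iso R s by (auto simp: mod_iso_def bij_betw_def Ga_mod_def ring_as_module_def)
  then obtain l where l: "l \<in> carrier (fib L R s)" "v R s l = \<one>\<^bsub>R\<^esub>" by auto
  define w where "w = teichmueller R r"
  have w: "w \<in> carrier (W_F p R)"
    unfolding w_def by (rule teichmueller_in_W_F[OF R prime_ge_2_nat[OF assms(2)] r(1,3)])
  define m where "m = \<iota> R s (pure_tensor R (fib L R s) (W_F p R) l w)"
  have "m \<in> carrier (fib M R s)"
    unfolding m_def by (rule linear_mapsD(1)[OF mod_map_linear[OF \<iota> R s]])
      (use pure_tensor_closed[OF l(1) w] in \<open>simp add: sharp_def Let_def\<close>)
  then obtain b where b: "b \<in> carrier (witt p R)" and m: "m = b \<odot>\<^bsub>fib M R s\<^esub> tr M K R j t e"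
    using gen[OF R j] unfolding s_def t_def by blast
  have eR: "tr M K R j t e \<in> carrier (fib M R s)"
    unfolding s_def using tr_closed[OF Mm K.is_cring R j tK] e by (simp add: t_def)
  have "\<xi> R s m = b \<otimes>\<^bsub>witt p R\<^esub> \<xi> R s (tr M K R j t e)"
    unfolding m using linear_mapsD(2)[OF mod_map_linear[OF \<xi> R s] _ eR] b
    by (simp add: W_def W_mod_def ring_as_module_def)
  also have "\<xi> R s (tr M K R j t e) = j \<circ> \<xi> K t e"
    unfolding s_def using mod_map_natural[OF \<xi> K.is_cring R j tK] e by (simp add: t_def W_mod_def)
  finally have "\<xi> R s m = b \<otimes>\<^bsub>witt p R\<^esub> (j \<circ> \<xi> K t e)" .
  \<comment> \<open>The vanishing at the field-valued point \<open>e\<close> passes along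
    \<open>j\<close> and then to the multiple \<open>m\<close>, although \<open>R\<close> has
    nilpotents.\<close>
  moreover have "\<xi> K t e 0 = \<zero>\<^bsub>K\<^esub>"
    unfolding t_def by (rule primitive_at_field_point[OF prim kx K h e])
  ultimately have "\<xi> R s m 0 = \<zero>\<^bsub>R\<^esub>"
    using b witt_mult_0[OF R, of b "j \<circ> \<xi> K t e" p] by (simp add: witt_def)
  moreover have "\<xi> R s m = v R s l \<odot>\<^bsub>W_F p R\<^esub> w"
    unfolding m_def using cf R s l(1) w by (simp add: comes_from_def)
  then have "\<xi> R s m = teichmueller R \<one>\<^bsub>R\<^esub> \<otimes>\<^bsub>witt p R\<^esub> w"
    by (simp add: l(2) W_F_def ring_as_module_def)
  \<comment> \<open>The second computation of the same component, through the sharp of the line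
    bundle, gives the nonzero \<open>r\<close>.\<close>
  then have "\<xi> R s m 0 = r"
    using r by (simp add: witt_mult_0[OF R] teichmueller_def w_def)
  ultimately show False using r(2) by simp
qed

end
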